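(* Let $n\ge 1$ be a natural number and let $F$ be a $\mathcal{C}^{2n+2}$ planar map defined on an open set $\mathcal{U}\subseteq\mathbb{R}^2$ with an elliptic fixed point $p\in\mathcal{U}$ which is not $(2n+1)$-resonant and such that its first non-vanishing Birkhoff constant is $B_n=i\,b_n$ for some $b_n\in\mathbb{R}\setminus\{0\}$. Assume moreover that $F$ is a measure preserving map with a non-vanishing density $\nu\in\mathcal{C}^{2n+3}$. If there is an unbounded sequence of natural numbers $\{N_k\}_k$ such that, for every $k$, $F$ has finitely many $N_k$-periodic points in $\mathcal{U}$, then $F$ is not $\mathcal{C}^{2n+4}$-locally integrable at $p$.
   Context: Elliptic fixed point: a fixed point $p$ of $F$ such that the eigenvalues $\lambda,\bar\lambda=1/\lambda$ of $DF(p)$ lie on the unit circle of $\mathbb{C}$ and are different from $\pm1$. It is not $k$-resonant if $\lambda^\ell\neq 1$ for all $0<\ell\le k$. Birkhoff constants: near a not $k$-resonant elliptic fixed point, a $\mathcal{C}^{k}$ map $F$ is locally conjugate (moving $p$ to $0$, with $z=x+iy$) to its Birkhoff normal form $F_B(z)=\lambda z\bigl(1+\sum_{j=1}^{[(k-1)/2]}B_j (z\bar z)^j\bigr)+o(|z|^k)$, where $[\cdot]$ is the integer part; the $B_j\in\mathbb{C}$ are the Birkhoff constants. "The first non-vanishing Birkhoff constant is $B_n$" means $B_1=\dots=B_{n-1}=0$ and $B_n\ne0$ (here with $k=2n+1$). Measure preserving with non-vanishing density $\nu$: $m(F^{-1}(B))=m(B)$ for every measurable set $B$, where $m(B)=\int_B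 \nu(x,y)\,dx\,dy$ and $\nu\neq0$ on $\mathcal{U}$. $N$-periodic point: a point $q$ with $F^N(q)=q$. $\mathcal{C}^m$-locally integrable at an elliptic fixed point $p$ ($m\ge2$): there exist a neighborhood $\mathcal{W}$ of $p$ and a locally non-constant real valued function $V\in\mathcal{C}^m(\mathcal{W})$ (a first integral) such that $V(F(x))=V(x)$, all the level curves $\{V=h\}\cap\mathcal{W}$ are closed curves surrounding $p$ and, moreover, $p$ is an isolated non-degenerate critical point of $V$ in $\mathcal{W}$. *)

theory Defs
  imports "HOL-Analysis.Analysis" "HOL-Library.Landau_Symbols"
begin

text \<open>A planar map on an open set \<open>U\<close> is a total function on \<open>real ^ 2\<close> of which only the
  restriction to \<open>U\<close> is relevant. The set \<open>S\<close> below is meant to be open.\<close>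

primrec Ck_on ::
  "nat \<Rightarrow> ('a::real_normed_vector \<Rightarrow> 'b::real_normed_vector) \<Rightarrow> 'a set \<Rightarrow> bool" where
  "Ck_on 0 f S \<longleftrightarrow> continuous_on S f"
| "Ck_on (Suc k) f S \<longleftrightarrow>
     (\<forall>x\<in>S. f differentiable (at x)) \<and>
     (\<forall>v. Ck_on k (\<lambda>x. frechet_derivative f (at x) v) S)"

definition jacobian_at :: "(real ^ 2 \<Rightarrow> real ^ 2) \<Rightarrow> real ^ 2 \<Rightarrow> real ^ 2 ^ 2" where
  "jacobian_at F p = matrix (frechet_derivative F (at p))"

definition complex_eigenvalue :: "real ^ 2 ^ 2 \<Rightarrow> complex \<Rightarrow> bool" where
  "complex_eigenvalue A l \<longleftrightarrow>
     (\<exists>v :: complex ^ 2. v \<noteq> 0 \<and> map_matrix complex_of_real A *v v = l *s v)"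

text \<open>An eigenvalue on the unit circle other than \<open>1\<close> and \<open>-1\<close> is not real; as the
  matrix is real, the two eigenvalues are then \<open>l\<close> and \<open>cnj l = 1 / l\<close>.\<close>

definition elliptic_fixed_point ::
  "(real ^ 2) set \<Rightarrow> (real ^ 2 \<Rightarrow> real ^ 2) \<Rightarrow> real ^ 2 \<Rightarrow> bool" where
  "elliptic_fixed_point U F p \<longleftrightarrow>
     p \<in> U \<and> F p = p \<and>
     (\<forall>l. complex_eigenvalue (jacobian_at F p) l \<longrightarrow> cmod l = 1 \<and> l \<noteq> 1 \<and> l \<noteq> -1)"

definition k_resonant :: "(real ^ 2 \<Rightarrow> real ^ 2) \<Rightarrow> real ^ 2 \<Rightarrow> nat \<Rightarrow> bool" where
  "k_resonant F p k \<longleftrightarrow>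
     (\<exists>l. complex_eigenvalue (jacobian_at F p) l \<and> (\<exists>j. 0 < j \<and> j \<le> k \<and> l ^ j = 1))"

text \<open>The plane is identified with \<open>complex\<close> by \<open>z = x + i y\<close>, so the conjugacy \<open>h\<close> is
  a local \<open>C\<^sup>k\<close> diffeomorphism from a neighbourhood of \<open>p\<close> to a neighbourhood of
  \<open>0\<close> in \<open>complex\<close>, regarded as a real vector space. The coefficients are determined only up to
  the choice of \<open>h\<close> (for instance a rescaling of \<open>z\<close>).\<close>

definition birkhoff_constants ::
  "(real ^ 2) set \<Rightarrow> (real ^ 2 \<Rightarrow> real ^ 2) \<Rightarrow> real ^ 2 \<Rightarrow> nat \<Rightarrow> (nat \<Rightarrow> complex) \<Rightarrow> bool" where
  "birkhoff_constants U F p k B \<longleftrightarrow>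
     (\<exists>A A' (h :: real ^ 2 \<Rightarrow> complex) g l.
        open A \<and> p \<in> A \<and> A \<subseteq> U \<and> open A' \<and>
        homeomorphism A A' h g \<and> Ck_on k h A \<and> Ck_on k g A' \<and> h p = 0 \<and>
        complex_eigenvalue (jacobian_at F p) l \<and>
        (\<lambda>z. h (F (g z)) - l * z * (1 + (\<Sum>j = 1..(k - 1) div 2. B j * (z * cnj z) ^ j)))
          \<in> o[at 0](\<lambda>z. complex_of_real (cmod z ^ k)))"

text \<open>The density may be of either sign, and the measure of a set may be infinite: equality
  is required for the sets \<open>E\<close> with a well-defined finite measure. When the density has constant sign
  this gives the equality for all measurable \<open>E\<close>, by sigma-finiteness.\<close>

definition measure_preserving_density ::
  "(real ^ 2) set \<Rightarrow> (real ^ 2 \<Rightarrow> real ^ 2) \<Rightarrow> (real ^ 2 \<Rightarrow> real) \<Rightarrow> bool" where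
  "measure_preserving_density U F \<nu> \<longleftrightarrow>
     (\<forall>E \<in> sets lebesgue. E \<subseteq> U \<longrightarrow> set_integrable lebesgue E \<nu> \<longrightarrow>
        set_integrable lebesgue (F -` E \<inter> U) \<nu> \<and>
        set_lebesgue_integral lebesgue (F -` E \<inter> U) \<nu> = set_lebesgue_integral lebesgue E \<nu>)"

text \<open>The whole orbit of a periodic point has to stay in the domain \<open>U\<close>.\<close>

definition periodic_points ::
  "(real ^ 2) set \<Rightarrow> (real ^ 2 \<Rightarrow> real ^ 2) \<Rightarrow> nat \<Rightarrow> (real ^ 2) set" where
  "periodic_points U F N = {q. (\<forall>j\<le>N. (F ^^ j) q \<in> U) \<and> (F ^^ N) q = q}"

definition critical_points :: "(real ^ 2 \<Rightarrow> real) \<Rightarrow> (real ^ 2) set \<Rightarrow> (real ^ 2) set" where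
  "critical_points V W = {x \<in> W. frechet_derivative V (at x) = (\<lambda>v. 0)}"

definition hessian :: "(real ^ 2 \<Rightarrow> real) \<Rightarrow> real ^ 2 \<Rightarrow> real ^ 2 ^ 2" where
  "hessian V p =
     (\<chi> i j. frechet_derivative (\<lambda>x. frechet_derivative V (at x) (axis j 1)) (at p) (axis i 1))"

definition closed_curve_surrounding :: "real ^ 2 \<Rightarrow> (real ^ 2) set \<Rightarrow> bool" where
  "closed_curve_surrounding p C \<longleftrightarrow>
     (\<exists>\<gamma>. simple_path \<gamma> \<and> pathfinish \<gamma> = pathstart \<gamma> \<and> path_image \<gamma> = C \<and> p \<in> inside C)"

text \<open>The level set through \<open>p\<close> itself is the degenerate closed curve \<open>{p}\<close>. Invariance is
  required wherever both sides make sense, as \<open>F\<close> need not map \<open>W\<close> into itself.\<close>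

definition Cm_locally_integrable ::
  "nat \<Rightarrow> (real ^ 2) set \<Rightarrow> (real ^ 2 \<Rightarrow> real ^ 2) \<Rightarrow> real ^ 2 \<Rightarrow> bool" where
  "Cm_locally_integrable m U F p \<longleftrightarrow>
     (\<exists>W V. open W \<and> p \<in> W \<and> W \<subseteq> U \<and> Ck_on m V W \<and>
        (\<forall>S. open S \<and> S \<noteq> {} \<and> S \<subseteq> W \<longrightarrow> \<not> V constant_on S) \<and>
        (\<forall>x\<in>W. F x \<in> W \<longrightarrow> V (F x) = V x) \<and>
        {x \<in> W. V x = V p} = {p} \<and>
        (\<forall>c \<in> V ` W - {V p}. closed_curve_surrounding p {x \<in> W. V x = c}) \<and>
        p isolated_in critical_points V W \<and> det (hessian V p) \<noteq> 0)"

end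

theory Submission
  imports Defs
begin

text \<open>Suppose that there is a first integral \<open>V\<close>. As \<open>p\<close> is a nondegenerate critical point and alone
  on its level, it is a strict extremum with definite Hessian. In the Birkhoff chart, up to sign,
  \<open>\<phi> = V - V p\<close> is therefore comparable to \<open>|z|\<^sup>2\<close> and strictly increasing on rays: orbits starting
  near \<open>0\<close> stay near \<open>0\<close>, at distances comparable to the initial one. The map turns \<open>z\<close> by the angle
  \<open>arg l + b |z|\<^sup>2\<^sup>n + o(|z|\<^sup>2\<^sup>n)\<close>, so over \<open>N\<close> steps the part of the turning in excess of \<open>N arg l\<close>
  tends to \<open>0\<close> as \<open>z\<close> tends to \<open>0\<close> along a fixed ray, but exceeds \<open>2 \<pi>\<close> in size at a fixed radius
  once \<open>N\<close> is large. Hence some point of the ray returns to that ray after \<open>N\<close> steps, at the same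
  value of \<open>\<phi>\<close>, and is \<open>N\<close>-periodic. Every ray yields such a point, so for all large \<open>N\<close> there are
  infinitely many \<open>N\<close>-periodic points.\<close>

section \<open>Twist maps of a disc with an invariant function\<close>

text \<open>The value at \<open>0\<close> is the limit for a map with linear part \<open>l\<close>.\<close>

definition multiplier :: "complex \<Rightarrow> (complex \<Rightarrow> complex) \<Rightarrow> complex \<Rightarrow> complex" where
  "multiplier l f z = (if z = 0 then 1 else f z / (l * z))"

text \<open>Dividing the twist estimate by \<open>cmod z\<close> puts the multiplier within a
  fraction of \<open>\<bar>b\<bar> * cmod z ^ (2 * n)\<close> of
  \<open>1 + \<i> * b * cmod z ^ (2 * n)\<close>. It therefore stays close to 1, where the principal
  logarithm is continuous and equals \<open>m - 1\<close> up to a quadratic error. Its imaginary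
  part is a genuine real number for the excess rotation of one step, with no ambiguity modulo 2
  pi.\<close>

lemma twist_multiplier_Ln:
  fixes f :: "complex \<Rightarrow> complex" and l :: complex and b R :: real and n :: nat
  assumes n: "n \<ge> 1" and R: "0 < R" and l: "cmod l = 1"
    and f: "continuous_on (ball 0 R) f"
    and twist: "\<forall>z\<in>ball 0 R.
      cmod (f z - l * z * (1 + \<i> * of_real (b * cmod z ^ (2 * n)))) \<le> \<bar>b\<bar> / 8 * cmod z ^ (2 * n + 1)"
    and small: "\<forall>z\<in>ball 0 R. \<bar>b\<bar> * cmod z ^ (2 * n) \<le> 1 / 32"
  shows "\<And>z. z \<in> ball 0 R \<Longrightarrow> f z = l * z * exp (Ln (multiplier l f z))"
    and "\<And>z. z \<in> ball 0 R \<Longrightarrow> cmod (f z) \<le> 2 * cmod z"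
    and "\<And>z. z \<in> ball 0 R \<Longrightarrow> \<bar>Im (Ln (multiplier l f z)) - b * cmod z ^ (2 * n)\<bar> \<le> \<bar>b\<bar> / 2 * cmod z ^ (2 * n)"
    and "continuous_on (ball 0 R) (\<lambda>z. Im (Ln (multiplier l f z)))"
proof -
  let ?m = "multiplier l f"
  note twist = twist[rule_format] and small = small[rule_format]
  have l0: "l \<noteq> 0" using l by auto
  have f0: "f 0 = 0" using twist[of 0] R by simp
  have fm: "f z = l * z * ?m z" for z using l0 f0 by (simp add: multiplier_def)
  have m1: "cmod (?m z - (1 + \<i> * of_real (b * cmod z ^ (2 * n)))) \<le> \<bar>b\<bar> / 8 * cmod z ^ (2 * n)"
    if z: "z \<in> ball 0 R" for z
  proof (cases "z = 0")
    case True then show ?thesis using n by (simp add: multiplier_def power_0_left)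
  next
    case False
    have "f z - l * z * (1 + \<i> * of_real (b * cmod z ^ (2 * n)))
        = l * z * (?m z - (1 + \<i> * of_real (b * cmod z ^ (2 * n))))"
      by (simp add: fm algebra_simps)
    with twist[OF z] have "cmod z * cmod (?m z - (1 + \<i> * of_real (b * cmod z ^ (2 * n))))
        \<le> cmod z * (\<bar>b\<bar> / 8 * cmod z ^ (2 * n))"
      by (simp only: norm_mult l) (simp add: algebra_simps)
    then show ?thesis using False by (subst (asm) mult_le_cancel_left_pos) auto
  qed
  have m2: "cmod (?m z - 1) \<le> 2 * (\<bar>b\<bar> * cmod z ^ (2 * n))" if z: "z \<in> ball 0 R" for z
  proof -
    have "cmod (?m z - 1) \<le> cmod (?m z - (1 + \<i> * of_real (b * cmod z ^ (2 * n))))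
        + cmod (\<i> * of_real (b * cmod z ^ (2 * n)))"
      by (rule order_trans[OF _ norm_triangle_ineq]) simp
    also have "cmod (\<i> * of_real (b * cmod z ^ (2 * n))) = \<bar>b\<bar> * cmod z ^ (2 * n)"
      by (simp add: norm_mult abs_mult norm_power)
    finally show ?thesis using m1[OF z] mult_nonneg_nonneg[OF abs_ge_zero[of b] zero_le_power[OF norm_ge_zero[of z], of "2 * n"]]
      by linarith
  qed
  have m3: "cmod (?m z - 1) \<le> 1 / 16" if z: "z \<in> ball 0 R" for z
    using m2[OF z] small[OF z] by linarith
  have mpos: "Re (?m z) > 0" if z: "z \<in> ball 0 R" for z
    using abs_Re_le_cmod[of "?m z - 1"] m3[OF z] by simp
  have m0: "?m z \<noteq> 0" if z: "z \<in> ball 0 R" for z using mpos[OF z] by auto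
  show "f z = l * z * exp (Ln (?m z))" if z: "z \<in> ball 0 R" for z
    using m0[OF z] fm by simp
  show "cmod (f z) \<le> 2 * cmod z" if z: "z \<in> ball 0 R" for z
  proof -
    have "cmod (?m z) \<le> 2" using m3[OF z] norm_triangle_ineq[of "?m z - 1" 1] by simp
    then show ?thesis by (simp add: fm norm_mult l mult.commute mult_left_mono)
  qed
  show "\<bar>Im (Ln (?m z)) - b * cmod z ^ (2 * n)\<bar> \<le> \<bar>b\<bar> / 2 * cmod z ^ (2 * n)"
    if z: "z \<in> ball 0 R" for z
  proof -
    define \<rho> where "\<rho> = \<bar>b\<bar> * cmod z ^ (2 * n)"
    define x where "x = cmod (?m z - 1)"
    have \<rho>: "0 \<le> \<rho>" "\<rho> \<le> 1 / 32" using small[OF z] by (auto simp: \<rho>_def)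
    have x: "0 \<le> x" "x \<le> 2 * \<rho>" "x \<le> 1 / 16" using m2[OF z] m3[OF z] by (auto simp: x_def \<rho>_def)
    \<comment> \<open>The bound 1/32 in \<open>small\<close> is what absorbs the quadratic error of
      the logarithm: with \<open>x \<le> 2 * \<rho>\<close> it is at most
      \<open>8 * \<rho>\<^sup>2\<close>, hence at most \<open>\<rho> / 4\<close>. Together with the
      \<open>\<rho> / 8\<close> from \<open>m1\<close> this stays below half of the main
      term.\<close>
    have "cmod (Ln (?m z) - (?m z - 1)) \<le> x\<^sup>2 / (1 - x)"
      using Ln_approx_linear[of "?m z - 1"] x by (simp add: x_def)
    also have "\<dots> \<le> x\<^sup>2 / (1 / 2)" using x by (intro divide_left_mono) auto
    also have "\<dots> \<le> (2 * \<rho>)\<^sup>2 * 2" using power_mono[OF x(2,1), of 2] by simp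
    also have "\<dots> \<le> \<rho> / 4"
      using mult_left_mono[OF \<rho>(2) \<rho>(1)] by (simp add: power2_eq_square)
    finally have A: "\<bar>Im (Ln (?m z)) - Im (?m z)\<bar> \<le> \<rho> / 4"
      using abs_Im_le_cmod[of "Ln (?m z) - (?m z - 1)"] by simp
    have "\<bar>Im (?m z) - b * cmod z ^ (2 * n)\<bar> \<le> \<rho> / 8"
      using m1[OF z] abs_Im_le_cmod[of "?m z - (1 + \<i> * of_real (b * cmod z ^ (2 * n)))"]
      by (simp add: \<rho>_def)
    with A have "\<bar>Im (Ln (?m z)) - b * cmod z ^ (2 * n)\<bar> \<le> \<rho> / 4 + \<rho> / 8" by linarith
    also have "\<dots> \<le> \<rho> / 2" using \<rho> by simp
    finally show ?thesis by (simp add: \<rho>_def)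
  qed
  have cm: "isCont ?m z" if z: "z \<in> ball 0 R" for z
  proof (cases "z = 0")
    case True
    have "((\<lambda>z. 2 * (\<bar>b\<bar> * cmod z ^ (2 * n))) \<longlongrightarrow> 2 * (\<bar>b\<bar> * cmod 0 ^ (2 * n))) (at 0)"
      by (intro tendsto_intros)
    then have T: "((\<lambda>z::complex. 2 * (\<bar>b\<bar> * cmod z ^ (2 * n))) \<longlongrightarrow> 0) (at 0)"
      using n by (simp add: power_0_left)
    have "((\<lambda>z. ?m z - 1) \<longlongrightarrow> 0) (at 0)"
      using eventually_at_in_open'[of "ball 0 R" "0::complex"] R
      by (intro Lim_null_comparison[OF _ T]) (auto elim!: eventually_mono intro: m2)
    then have "(?m \<longlongrightarrow> 1) (at 0)" using LIM_zero_iff by blast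
    then show ?thesis using True by (simp add: isCont_def multiplier_def)
  next
    case False
    have "isCont f z" using f z continuous_on_eq_continuous_at open_ball by blast
    then have c: "isCont (\<lambda>w. f w / (l * w)) z" using False l0 by (intro continuous_intros) auto
    have "eventually (\<lambda>w. ?m w = f w / (l * w)) (nhds z)"
      using t1_space_nhds[OF False] by eventually_elim (simp add: multiplier_def)
    then show ?thesis using c by (subst isCont_cong) auto
  qed
  have "isCont (\<lambda>z. Im (Ln (?m z))) z" if z: "z \<in> ball 0 R" for z
  proof -
    have "?m z \<notin> \<real>\<^sub>\<le>\<^sub>0" using mpos[OF z] by (auto simp: complex_nonpos_Reals_iff)
    then show ?thesis using continuous_Im[OF isCont_Ln'[OF cm[OF z]]] by blast
  qed
  then show "continuous_on (ball 0 R) (\<lambda>z. Im (Ln (?m z)))"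
    using continuous_at_imp_continuous_on by blast
qed

text \<open>Points with equal \<open>\<phi>\<close> have norms within a factor \<open>K\<close> of
  each other, but invariance is only available once the image is known to lie in the ball. The
  reserve factor 2 in \<open>2 * K * norm z < R\<close> covers this: one step at most doubles the
  norm, so the image is still in the ball, and then comparability restores the bound
  \<open>K * norm z\<close> for the next step.\<close>

lemma invariant_function_orbit_bounds:
  fixes f :: "'a::real_normed_vector \<Rightarrow> 'a" and \<phi> :: "'a \<Rightarrow> real"
  assumes c: "0 < c" and K: "1 \<le> K" "C \<le> c * K\<^sup>2" and d: "2 * K * norm z < R"
    and quad: "\<forall>w\<in>ball 0 R. c * (norm w)\<^sup>2 \<le> \<phi> w \<and> \<phi> w \<le> C * (norm w)\<^sup>2"
    and inv: "\<forall>w\<in>ball 0 R. f w \<in> ball 0 R \<longrightarrow> \<phi> (f w) = \<phi> w"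
    and growth: "\<forall>w\<in>ball 0 R. norm (f w) \<le> 2 * norm w"
  shows "norm ((f ^^ j) z) \<le> K * norm z" "norm z \<le> K * norm ((f ^^ j) z)"
    "\<phi> ((f ^^ j) z) = \<phi> z" "(f ^^ j) z \<in> ball 0 R"
proof -
  note quad = quad[rule_format] and inv = inv[rule_format] and growth = growth[rule_format]
  have Kz: "norm z \<le> K * norm z" using K(1) mult_right_mono[of 1 K "norm z"] by simp
  have z: "z \<in> ball 0 R" using Kz d norm_ge_zero[of z] by (simp only: mem_ball_0)
  have comp: "norm x \<le> K * norm y" if "x \<in> ball 0 R" "y \<in> ball 0 R" "\<phi> x = \<phi> y" for x y
  proof -
    have "c * (norm x)\<^sup>2 \<le> C * (norm y)\<^sup>2" using quad[OF that(1)] quad[OF that(2)] that(3) by linarith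
    also have "\<dots> \<le> (c * K\<^sup>2) * (norm y)\<^sup>2" by (intro mult_right_mono K) auto
    finally have "c * (norm x)\<^sup>2 \<le> c * (K * norm y)\<^sup>2" by (simp add: power_mult_distrib)
    then have "(norm x)\<^sup>2 \<le> (K * norm y)\<^sup>2" using c by simp
    then show ?thesis using K(1) by (intro power2_le_imp_le[of "norm x"]) auto
  qed
  have *: "norm ((f ^^ j) z) \<le> K * norm z \<and> \<phi> ((f ^^ j) z) = \<phi> z \<and> (f ^^ j) z \<in> ball 0 R"
  proof (induction j)
    case 0 then show ?case using Kz z by simp
  next
    case (Suc j)
    let ?w = "(f ^^ j) z"
    have "norm (f ?w) \<le> 2 * (K * norm z)" using growth[of ?w] Suc by linarith
    then have fw: "f ?w \<in> ball 0 R" using d by simp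
    with inv[of ?w] Suc have "\<phi> (f ?w) = \<phi> z" by simp
    with comp[OF fw z] fw show ?case by simp
  qed
  then show "norm ((f ^^ j) z) \<le> K * norm z" "\<phi> ((f ^^ j) z) = \<phi> z" "(f ^^ j) z \<in> ball 0 R" by auto
  show "norm z \<le> K * norm ((f ^^ j) z)" using comp[of z "(f ^^ j) z"] * z by simp
qed

text \<open>The angle is adjusted by the twist and the radius by \<open>\<phi>\<close>. The
  threshold \<open>N0\<close> is uniform in \<open>u\<close> because the rotation per step on the
  circle of radius \<open>d\<close> is bounded below independently of the direction; a single period
  thus serves all rays.\<close>

lemma twist_periodic_orbits_on_rays:
  fixes f :: "complex \<Rightarrow> complex" and \<phi> :: "complex \<Rightarrow> real" and l :: complex and b R :: real and n :: nat
  assumes n: "n \<ge> 1" and R: "0 < R" and l: "cmod l = 1" and b: "b \<noteq> 0"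
    and f: "continuous_on (ball 0 R) f"
    and twist: "\<forall>z\<in>ball 0 R.
      cmod (f z - l * z * (1 + \<i> * of_real (b * cmod z ^ (2 * n)))) \<le> \<bar>b\<bar> / 8 * cmod z ^ (2 * n + 1)"
    and c: "0 < c"
    and quad: "\<forall>z\<in>ball 0 R. c * (cmod z)\<^sup>2 \<le> \<phi> z \<and> \<phi> z \<le> C * (cmod z)\<^sup>2"
    and ray: "\<And>z s. z \<in> ball 0 R \<Longrightarrow> z \<noteq> 0 \<Longrightarrow> 0 < s \<Longrightarrow> s < 1 \<Longrightarrow> \<phi> (of_real s * z) < \<phi> z"
    and inv: "\<forall>z\<in>ball 0 R. f z \<in> ball 0 R \<longrightarrow> \<phi> (f z) = \<phi> z"
  shows "\<exists>N0. \<forall>N\<ge>N0. \<forall>u. cmod u = 1 \<longrightarrow> (\<exists>r>0. (\<forall>j. (f ^^ j) (of_real r * u) \<in> ball 0 R) \<and>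
    (f ^^ N) (of_real r * u) = of_real r * u)"
proof -
  have "((\<lambda>x. \<bar>b\<bar> * x ^ (2 * n)) \<longlongrightarrow> \<bar>b\<bar> * 0 ^ (2 * n)) (at_right (0::real))"
    by (intro tendsto_intros)
  then have "((\<lambda>x. \<bar>b\<bar> * x ^ (2 * n)) \<longlongrightarrow> 0) (at_right (0::real))"
    using n by (simp add: power_0_left)
  then have "eventually (\<lambda>x. \<bar>b\<bar> * x ^ (2 * n) < 1 / 32) (at_right (0::real))"
    by (rule order_tendstoD) simp
  moreover have "eventually (\<lambda>x. x < R) (at_right (0::real))"
    using R eventually_at_right by blast
  moreover have "eventually (\<lambda>x. x > 0) (at_right (0::real))"
    by (rule eventually_at_right_less)
  ultimately have "eventually (\<lambda>x. \<bar>b\<bar> * x ^ (2 * n) < 1 / 32 \<and> x < R \<and> x > 0) (at_right (0::real))"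
    by eventually_elim auto
  then obtain R1 where R1: "\<bar>b\<bar> * R1 ^ (2 * n) < 1 / 32" "R1 < R" "R1 > 0"
    using eventually_happens'[OF trivial_limit_at_right_real] by blast
  have sub: "ball 0 R1 \<subseteq> (ball 0 R :: complex set)" using R1 by auto
  have small: "\<forall>z\<in>ball 0 R1. \<bar>b\<bar> * cmod z ^ (2 * n) \<le> 1 / 32"
  proof
    fix z :: complex assume "z \<in> ball 0 R1"
    then have "\<bar>b\<bar> * cmod z ^ (2 * n) \<le> \<bar>b\<bar> * R1 ^ (2 * n)"
      by (intro mult_left_mono power_mono) auto
    then show "\<bar>b\<bar> * cmod z ^ (2 * n) \<le> 1 / 32" using R1 by linarith
  qed
  let ?m = "multiplier l f"
  have twist1: "\<forall>z\<in>ball 0 R1. cmod (f z - l * z * (1 + \<i> * of_real (b * cmod z ^ (2 * n))))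
      \<le> \<bar>b\<bar> / 8 * cmod z ^ (2 * n + 1)"
    using twist sub by blast
  note tw = twist_multiplier_Ln[OF n R1(3) l continuous_on_subset[OF f sub] twist1 small]
  \<comment> \<open>This \<open>K\<close> gives \<open>C = c * K\<^sup>2\<close>; that it is at
    least 1 follows by testing the two bounds at a single nonzero point. Below, \<open>d\<close> is
    chosen so that \<open>2 * K * d = R1 / 2\<close>, which keeps all orbits starting in the closed
    disc of radius \<open>d\<close> inside the ball of radius \<open>R1\<close>.\<close>
  define K where "K = sqrt (C / c)"
  have "0 < R / 2" using R by simp
  then have "complex_of_real (R / 2) \<in> ball 0 R" by (simp add: norm_of_real)
  moreover have "cmod (complex_of_real (R / 2)) = R / 2" using R by simp
  ultimately have "c * (R / 2)\<^sup>2 \<le> C * (R / 2)\<^sup>2" using quad by (metis order_trans)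
  then have "c \<le> C" using R by simp
  then have K: "1 \<le> K" "C \<le> c * K\<^sup>2" using c by (auto simp: K_def)
  define d where "d = R1 / (4 * K)"
  have d: "d > 0" "2 * K * d < R1" using R1 K by (auto simp: d_def field_simps)
  have Kd: "2 * K * cmod z < R1" if "cmod z \<le> d" for z
    using mult_left_mono[OF that, of "2 * K"] K d by linarith
  have quad1: "\<forall>w\<in>ball 0 R1. c * (cmod w)\<^sup>2 \<le> \<phi> w \<and> \<phi> w \<le> C * (cmod w)\<^sup>2"
    and inv1: "\<forall>w\<in>ball 0 R1. f w \<in> ball 0 R1 \<longrightarrow> \<phi> (f w) = \<phi> w"
    and growth1: "\<forall>w\<in>ball 0 R1. cmod (f w) \<le> 2 * cmod w"
    using quad inv sub tw(2) by blast+
  note orb = invariant_function_orbit_bounds[OF c K Kd quad1 inv1 growth1]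
  \<comment> \<open>The accumulated excess rotation over \<open>N\<close> steps, as a continuous
    real-valued lift. Being real, it can be fed to the intermediate value theorem.\<close>
  define S where "S = (\<lambda>N z. \<Sum>j<N. Im (Ln (?m ((f ^^ j) z))))"
  have iter: "(f ^^ N) z = l ^ N * z * exp (\<Sum>j<N. Ln (?m ((f ^^ j) z)))" if z: "cmod z \<le> d" for N z
  proof (induction N)
    case (Suc N)
    have "(f ^^ Suc N) z = l * (f ^^ N) z * exp (Ln (?m ((f ^^ N) z)))"
      using tw(1)[OF orb(4)[OF z, of N]] by simp
    also have "\<dots> = l ^ Suc N * z * exp (\<Sum>j<Suc N. Ln (?m ((f ^^ j) z)))"
      by (subst Suc) (simp add: exp_add mult_ac)
    finally show ?case .
  qed simp
  have contf: "continuous_on {0..d} (\<lambda>t. (f ^^ j) (of_real t * u))" if u: "cmod u = 1" for u j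
  proof (induction j)
    case 0 show ?case by (auto intro!: continuous_intros)
  next
    case (Suc j)
    have "continuous_on {0..d} (\<lambda>t. f ((f ^^ j) (of_real t * u)))"
      by (rule continuous_on_compose2[OF continuous_on_subset[OF f sub] Suc])
        (use orb(4) u in \<open>auto simp: norm_mult\<close>)
    then show ?case by simp
  qed
  have contS: "continuous_on {0..d} (\<lambda>t. sgn b * S N (of_real t * u))" if u: "cmod u = 1" for u N
    unfolding S_def
    by (intro continuous_intros continuous_on_compose2[OF tw(4) contf[OF u]])
        (use orb(4) u in \<open>auto simp: norm_mult\<close>)
  \<comment> \<open>An orbit starting at radius \<open>d\<close> never comes closer to 0 than
    \<open>d / K\<close>, and each step there turns by at least half of \<open>\<bar>b\<bar>\<close>
    times the power of the radius, in the direction given by \<open>sgn b\<close>. So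
    \<open>a\<close> bounds the turning per step from below, and \<open>N0\<close> steps accumulate
    a full turn.\<close>
  define a where "a = \<bar>b\<bar> / 2 * (d / K) ^ (2 * n)"
  have a: "a > 0" using b d K by (simp add: a_def)
  obtain N0 :: nat where N0: "2 * pi / a < N0" using reals_Archimedean2 by blast
  show ?thesis
  proof (intro exI[of _ N0] allI impI)
    fix N u assume N: "N \<ge> N0" and u: "cmod u = 1"
    have lower: "a \<le> sgn b * Im (Ln (?m ((f ^^ j) (of_real d * u))))" for j
    proof -
      let ?w = "(f ^^ j) (of_real d * u)"
      have dn: "cmod (of_real d * u) = d" using u d by (simp add: norm_mult)
      have w: "?w \<in> ball 0 R1" using orb(4)[of "of_real d * u" j] dn by simp
      have "d \<le> K * cmod ?w" using orb(2)[of "of_real d * u" j] dn by simp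
      then have "d / K \<le> cmod ?w" using K by (simp add: field_simps)
      then have "a \<le> \<bar>b\<bar> / 2 * cmod ?w ^ (2 * n)"
        unfolding a_def using d K by (intro mult_left_mono power_mono) auto
      also have "\<dots> \<le> sgn b * Im (Ln (?m ?w))"
      proof (cases "b > 0")
        case True
        then have "\<bar>b\<bar> = b" "sgn b = 1" by auto
        then show ?thesis using tw(3)[OF w] by (simp only:)
      next
        case False
        then have "\<bar>b\<bar> = - b" "sgn b = - 1" using b by auto
        then show ?thesis using tw(3)[OF w] by (simp only:)
      qed
      finally show ?thesis .
    qed
    have "2 * pi \<le> real N * a" using N0 N a
    proof -
      have "2 * pi / a \<le> real N" using N0 N by linarith
      then show ?thesis using a by (simp add: pos_divide_le_eq)
    qed
    also have "\<dots> = (\<Sum>j<N. a)" by simp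
    also have "\<dots> \<le> sgn b * S N (of_real d * u)"
      unfolding S_def sum_distrib_left by (intro sum_mono lower)
    finally have big: "2 * pi \<le> sgn b * S N (of_real d * u)" .
    have f0: "f 0 = 0" using twist[rule_format, of 0] R by simp
    \<comment> \<open>The value 1 of \<open>multiplier\<close> at 0 has logarithm 0, so the lift
      starts at 0 at the inner end of the ray.\<close>
    have "(f ^^ j) 0 = 0" for j by (induction j) (auto simp: f0)
    then have S0: "S N 0 = 0" by (simp add: S_def multiplier_def)
    \<comment> \<open>A return to the ray means \<open>cis (S N z) = inverse (l ^ N)\<close>. Since
      only \<open>sgn b * S N z\<close> is prescribed, the target for negative \<open>b\<close> is
      the inverse of this number.\<close>
    define w where "w = (if b > 0 then inverse (l ^ N) else l ^ N)"
    have w1: "cmod w = 1" by (simp add: w_def norm_inverse norm_power l)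
    \<comment> \<open>The argument 0 is replaced by \<open>2 * pi\<close>: a positive target forces
      the parameter \<open>t\<close> found below to be nonzero, so the periodic point is not the
      origin.\<close>
    define \<tau> where "\<tau> = (if Arg2pi w = 0 then 2 * pi else Arg2pi w)"
    have "cis (Arg2pi w) = w" using Arg2pi_eq[of w] w1 by (simp add: cis_conv_exp)
    then have \<tau>: "0 < \<tau>" "\<tau> \<le> 2 * pi" "cis \<tau> = w"
      using Arg2pi[of w] by (auto simp: \<tau>_def)
    obtain t where t: "0 \<le> t" "t \<le> d" "sgn b * S N (of_real t * u) = \<tau>"
      using IVT'[of "\<lambda>t. sgn b * S N (of_real t * u)" 0 \<tau> d] S0 \<tau> big d contS[OF u] by auto
    have t0: "t > 0" using t \<tau> S0 by (cases "t = 0") auto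
    define z where "z = of_real t * u"
    have z: "cmod z \<le> d" "z \<noteq> 0" using t t0 u by (auto simp: z_def norm_mult)
    have lN: "l ^ N \<noteq> 0" using l by auto
    have S: "l ^ N * cis (S N z) = 1"
    proof (cases "b > 0")
      case True
      then have "S N z = \<tau>" using t by (simp add: z_def)
      then show ?thesis using \<tau>(3) lN True by (simp add: w_def)
    next
      case False
      then have "S N z = - \<tau>" using t b by (simp add: z_def)
      then have "cis (S N z) = inverse (l ^ N)" using \<tau>(3) False by (simp add: w_def flip: cis_inverse)
      then show ?thesis using lN by simp
    qed
    define k where "k = exp (Re (\<Sum>j<N. Ln (?m ((f ^^ j) z))))"
    have k0: "k > 0" by (simp add: k_def)
    have "exp (\<Sum>j<N. Ln (?m ((f ^^ j) z))) = of_real k * cis (S N z)"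
      by (simp add: exp_eq_polar k_def S_def)
    then have kz: "(f ^^ N) z = of_real k * z" using iter[OF z(1), of N] S by (simp add: mult_ac)
    have inR: "(f ^^ j) z \<in> ball 0 R" for j using orb(4)[OF z(1)] sub by blast
    have eq: "\<phi> (of_real k * z) = \<phi> z" using orb(3)[OF z(1), of N] kz by simp
    \<comment> \<open>The endpoint is a positive multiple of \<open>z\<close> with the same
      \<open>\<phi>\<close>, and \<open>\<phi>\<close> is strictly increasing along the ray. If
      \<open>k > 1\<close>, the monotonicity is applied at the endpoint with factor
      \<open>1 / k\<close>.\<close>
    have "k = 1"
    proof (rule ccontr)
      assume "k \<noteq> 1"
      then consider "k < 1" | "k > 1" by linarith
      then show False
      proof cases
        case 1 then show ?thesis using ray[of z k] inR[of 0] z k0 eq by simp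
      next
        case 2
        then have "\<phi> (of_real (1 / k) * (of_real k * z)) < \<phi> (of_real k * z)"
          using ray[of "of_real k * z" "1 / k"] inR[of N] kz z k0 by simp
        then show ?thesis using k0 eq by simp
      qed
    qed
    then show "\<exists>r>0. (\<forall>j. (f ^^ j) (of_real r * u) \<in> ball 0 R) \<and>
        (f ^^ N) (of_real r * u) = of_real r * u"
      using t0 inR kz by (auto simp: z_def)
  qed
qed

section \<open>Derivatives of \<open>Ck_on\<close> maps and symmetry of second derivatives\<close>

lemma Ck_on_imp_continuous_on: "Ck_on k f S \<Longrightarrow> continuous_on S f"
  by (cases k) (auto intro!: continuous_at_imp_continuous_on differentiable_imp_continuous_within)

lemma Ck_on_Suc_has_derivative:
  "Ck_on (Suc k) f S \<Longrightarrow> x \<in> S \<Longrightarrow> (f has_derivative frechet_derivative f (at x)) (at x)"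
  using frechet_derivative_works by auto

lemma Ck_on_subset: "Ck_on k f S \<Longrightarrow> T \<subseteq> S \<Longrightarrow> Ck_on k f T"
  by (induction k arbitrary: f) (auto intro: continuous_on_subset)

text \<open>The second difference is symmetric in \<open>v\<close> and \<open>w\<close>, which yields the symmetry of the second
  derivative.\<close>

lemma second_difference_tendsto:
  fixes V :: "'a::real_normed_vector \<Rightarrow> real"
  assumes S: "open S" "p \<in> S" and V: "\<And>x. x \<in> S \<Longrightarrow> (V has_derivative V' x) (at x)"
    and H: "((\<lambda>x. V' x v) has_derivative H) (at p)"
  shows "((\<lambda>s. (V (p + s *\<^sub>R v + s *\<^sub>R w) - V (p + s *\<^sub>R v) - V (p + s *\<^sub>R w) + V p) / s\<^sup>2)
    \<longlongrightarrow> H w) (at_right 0)"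
proof (rule tendstoI)
  fix e :: real assume e: "e > 0"
  \<comment> \<open>For \<open>t\<close> and \<open>q\<close> between 0 and \<open>s\<close>, the
    displacement \<open>t *\<^sub>R v + q *\<^sub>R w\<close> has norm at most \<open>s * M\<close>;
    the summand 1 only keeps \<open>M\<close> positive. With \<open>e1 = e / (4 * M)\<close> the two
    linearisation errors add up to \<open>e / 2 * s\<close>.\<close>
  define M where "M = norm v + norm w + 1"
  have M: "M > 0" by (auto simp: M_def intro: add_nonneg_pos)
  define e1 where "e1 = e / (4 * M)"
  have e1: "e1 > 0" using e M by (simp add: e1_def)
  obtain d1 where d1: "d1 > 0" "\<And>y. norm (y - p) < d1 \<Longrightarrow>
      norm (V' y v - V' p v - H (y - p)) \<le> e1 * norm (y - p)"
    using H e1 unfolding has_derivative_at_alt by metis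
  obtain d2 where d2: "d2 > 0" "ball p d2 \<subseteq> S" using S open_contains_ball by blast
  define d where "d = min d1 d2"
  have d: "d > 0" using d1 d2 by (simp add: d_def)
  have linH: "linear H" using H has_derivative_linear by blast
  have main: "dist ((V (p + s *\<^sub>R v + s *\<^sub>R w) - V (p + s *\<^sub>R v) - V (p + s *\<^sub>R w) + V p) / s\<^sup>2) (H w) < e"
    if s: "0 < s" "s < d / M" for s
  proof -
    have sM: "s * M < d" using s M by (simp add: field_simps)
    have nx: "norm (t *\<^sub>R v + q *\<^sub>R w) \<le> s * M" if "0 \<le> t" "t \<le> s" "0 \<le> q" "q \<le> s" for t q
    proof -
      have "norm (t *\<^sub>R v + q *\<^sub>R w) \<le> t * norm v + q * norm w"
        by (rule order_trans[OF norm_triangle_ineq]) (use that in simp)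
      also have "\<dots> \<le> s * norm v + s * norm w"
        using that by (intro add_mono mult_right_mono) auto
      also have "\<dots> \<le> s * M" using s by (simp add: M_def algebra_simps)
      finally show ?thesis .
    qed
    have mem: "p + t *\<^sub>R v + q *\<^sub>R w \<in> S" if "0 \<le> t" "t \<le> s" "0 \<le> q" "q \<le> s" for t q
    proof -
      have "p - (p + t *\<^sub>R v + q *\<^sub>R w) = - (t *\<^sub>R v + q *\<^sub>R w)" by simp
      then have "dist p (p + t *\<^sub>R v + q *\<^sub>R w) = norm (t *\<^sub>R v + q *\<^sub>R w)"
        by (simp only: dist_norm norm_minus_cancel)
      then have "p + t *\<^sub>R v + q *\<^sub>R w \<in> ball p d2" using nx[OF that] sM by (simp add: d_def)
      then show ?thesis using d2 by blast
    qed
    have D: "((\<lambda>t. V (p + t *\<^sub>R v + q *\<^sub>R w)) has_real_derivative V' (p + t *\<^sub>R v + q *\<^sub>R w) v) (at t)"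
      if "0 \<le> t" "t \<le> s" "0 \<le> q" "q \<le> s" for t q
    proof -
      have "((\<lambda>t. p + t *\<^sub>R v + q *\<^sub>R w) has_derivative (\<lambda>h. h *\<^sub>R v)) (at t)"
        by (auto intro!: derivative_eq_intros)
      from has_derivative_compose[OF this V[OF mem[OF that]]]
      show ?thesis
        by (rule has_derivative_imp_has_field_derivative)
          (simp add: linear_cmul[OF has_derivative_linear[OF V[OF mem[OF that]]]])
    qed
    \<comment> \<open>The mean value theorem is applied to the difference of \<open>V\<close> along
      two parallel segments in direction \<open>v\<close>, shifted by \<open>s *\<^sub>R w\<close>.
      This leaves a difference of first derivatives, which differentiability at \<open>p\<close>
      alone controls.\<close>
    have "\<exists>x. 0 < x \<and> x < s \<and>
      (V (p + s *\<^sub>R v + s *\<^sub>R w) - V (p + s *\<^sub>R v + 0 *\<^sub>R w)) - (V (p + 0 *\<^sub>R v + s *\<^sub>R w) - V (p + 0 *\<^sub>R v + 0 *\<^sub>R w))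
      = (s - 0) * (V' (p + x *\<^sub>R v + s *\<^sub>R w) v - V' (p + x *\<^sub>R v + 0 *\<^sub>R w) v)"
      using s by (intro MVT2 DERIV_diff D) auto
    then obtain x where x: "0 < x" "x < s" and
      eq: "V (p + s *\<^sub>R v + s *\<^sub>R w) - V (p + s *\<^sub>R v) - V (p + s *\<^sub>R w) + V p
      = s * (V' (p + x *\<^sub>R v + s *\<^sub>R w) v - V' (p + x *\<^sub>R v + 0 *\<^sub>R w) v)"
      by auto
    have est: "\<bar>V' (p + x *\<^sub>R v + q *\<^sub>R w) v - V' p v - H (x *\<^sub>R v + q *\<^sub>R w)\<bar> \<le> e1 * (s * M)"
      if q: "0 \<le> q" "q \<le> s" for q
    proof -
      have n: "norm (x *\<^sub>R v + q *\<^sub>R w) \<le> s * M" using x q by (intro nx) auto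
      then have "norm (x *\<^sub>R v + q *\<^sub>R w) < d1" using sM by (simp add: d_def)
      then have "\<bar>V' (p + x *\<^sub>R v + q *\<^sub>R w) v - V' p v - H (x *\<^sub>R v + q *\<^sub>R w)\<bar>
        \<le> e1 * norm (x *\<^sub>R v + q *\<^sub>R w)"
        using d1(2)[of "p + x *\<^sub>R v + q *\<^sub>R w"] by (simp add: add.assoc)
      also have "\<dots> \<le> e1 * (s * M)" using n e1 by (intro mult_left_mono) auto
      finally show ?thesis .
    qed
    have "H (x *\<^sub>R v + s *\<^sub>R w) = H (x *\<^sub>R v + 0 *\<^sub>R w) + s * H w"
      using linH by (simp add: linear_add linear_cmul)
    then have "\<bar>V' (p + x *\<^sub>R v + s *\<^sub>R w) v - V' (p + x *\<^sub>R v + 0 *\<^sub>R w) v - s * H w\<bar> \<le> 2 * (e1 * (s * M))"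
      using est[of s] est[of 0] s by linarith
    also have "\<dots> = e / 2 * s" using M by (simp add: e1_def)
    finally have "\<bar>V' (p + x *\<^sub>R v + s *\<^sub>R w) v - V' (p + x *\<^sub>R v + 0 *\<^sub>R w) v - s * H w\<bar> / s \<le> e / 2"
      using s by (simp only: pos_divide_le_eq)
    moreover have "s * X / s\<^sup>2 - H w = (X - s * H w) / s" for X
      using s by (simp add: power2_eq_square field_simps)
    ultimately have "\<bar>s * (V' (p + x *\<^sub>R v + s *\<^sub>R w) v - V' (p + x *\<^sub>R v + 0 *\<^sub>R w) v) / s\<^sup>2 - H w\<bar> \<le> e / 2"
      using s by (simp only: abs_divide abs_of_pos)
    then show ?thesis unfolding eq dist_real_def by (rule le_less_trans) (use e in simp)
  qed
  have "eventually (\<lambda>s. 0 < s \<and> s < d / M) (at_right (0::real))"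
    using d M unfolding eventually_at_right[OF zero_less_one] by (intro exI[of _ "d / M"]) auto
  then show "eventually (\<lambda>s. dist ((V (p + s *\<^sub>R v + s *\<^sub>R w) - V (p + s *\<^sub>R v) - V (p + s *\<^sub>R w) + V p) / s\<^sup>2) (H w) < e) (at_right 0)"
    by eventually_elim (use main in blast)
qed

lemma second_derivative_symmetric:
  fixes V :: "'a::real_normed_vector \<Rightarrow> real"
  assumes "open S" "p \<in> S" "\<And>x. x \<in> S \<Longrightarrow> (V has_derivative V' x) (at x)"
    and "((\<lambda>x. V' x v) has_derivative Hv) (at p)" and "((\<lambda>x. V' x w) has_derivative Hw) (at p)"
  shows "Hv w = Hw v"
proof -
  have "((\<lambda>s. (V (p + s *\<^sub>R v + s *\<^sub>R w) - V (p + s *\<^sub>R v) - V (p + s *\<^sub>R w) + V p) / s\<^sup>2) \<longlongrightarrow> Hw v) (at_right 0)"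
    using second_difference_tendsto[OF assms(1-3,5), of v] by (simp add: algebra_simps)
  then show ?thesis
    using second_difference_tendsto[OF assms(1-4), of w] tendsto_unique trivial_limit_at_right_real by blast
qed

section \<open>Gradient, Hessian and definiteness at an isolated level\<close>

text \<open>Completing the square writes \<open>a\<close> times the form as
  \<open>(a * x + b * y)\<^sup>2 + (a * d - b\<^sup>2) * y\<^sup>2\<close>. Testing nonnegativity at
  \<open>(-b, a)\<close> shows that the nonzero determinant is positive.\<close>

lemma real_quadratic_form_definite:
  fixes a b d :: real
  assumes nn: "\<And>x y. a * x\<^sup>2 + 2 * b * x * y + d * y\<^sup>2 \<ge> 0" and det: "a * d - b\<^sup>2 \<noteq> 0"
    and xy: "x \<noteq> 0 \<or> y \<noteq> 0"
  shows "a * x\<^sup>2 + 2 * b * x * y + d * y\<^sup>2 > 0"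
proof -
  let ?q = "\<lambda>x y. a * x\<^sup>2 + 2 * b * x * y + d * y\<^sup>2"
  have a: "a \<ge> 0" and d: "d \<ge> 0" using nn[of 1 0] nn[of 0 1] by auto
  have a0: "a \<noteq> 0"
  proof
    assume a: "a = 0"
    then have "b \<noteq> 0" using det by auto
    \<comment> \<open>For \<open>a = 0\<close> the form is affine in \<open>x\<close> on the line
      \<open>y = 1\<close>; the chosen \<open>x\<close> makes its value -1.\<close>
    then show False using nn[of "- (d + 1) / (2 * b)" 1] a by (simp add: field_simps)
  qed
  have "?q (-b) a = a * (a * d - b\<^sup>2)" by (simp add: power2_eq_square algebra_simps)
  then have "a * (a * d - b\<^sup>2) \<ge> 0" using nn[of "-b" a] by metis
  then have dp: "a * d - b\<^sup>2 > 0" using a a0 det by (simp add: zero_le_mult_iff)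
  have "a * ?q x y = (a * x + b * y)\<^sup>2 + (a * d - b\<^sup>2) * y\<^sup>2"
    by (simp add: power2_eq_square algebra_simps)
  also have "\<dots> > 0"
  proof (cases "y = 0")
    case True then show ?thesis using xy a0 by simp
  next
    case False then show ?thesis using dp by (intro add_nonneg_pos) auto
  qed
  finally show ?thesis using a a0 by (simp add: zero_less_mult_iff)
qed

text \<open>Collecting the partial derivatives in a vector turns the derivative into a map of the
  plane that can be differentiated in turn.\<close>

definition gradient :: "(real ^ 2 \<Rightarrow> real) \<Rightarrow> real ^ 2 \<Rightarrow> real ^ 2" where
  "gradient V x = (\<chi> i. frechet_derivative V (at x) (axis i 1))"

lemma inner_gradient:
  assumes "V differentiable (at x)"
  shows "gradient V x \<bullet> v = frechet_derivative V (at x) v"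
proof -
  have "linear (frechet_derivative V (at x))"
    using assms frechet_derivative_works has_derivative_linear by blast
  then have "frechet_derivative V (at x) (\<Sum>i\<in>UNIV. v $ i *\<^sub>R axis i 1) = gradient V x \<bullet> v"
    by (simp add: linear_sum linear_cmul gradient_def inner_vec_def mult.commute)
  moreover have "(\<Sum>i\<in>UNIV. v $ i *\<^sub>R axis i 1) = v"
    using basis_expansion[of v] by (simp add: scalar_mult_eq_scaleR)
  ultimately show ?thesis by simp
qed

text \<open>The vector multiplies from the left because the row index of \<open>hessian\<close> is
  the direction of the second differentiation and the column index is the component of the
  gradient.\<close>

lemma gradient_has_derivative_hessian:
  assumes V: "Ck_on (Suc (Suc k)) V S" and x: "x \<in> S"
  shows "(gradient V has_derivative (\<lambda>v. v v* hessian V x)) (at x)"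
proof -
  have comp: "((\<lambda>x. frechet_derivative V (at x) (axis j 1)) has_derivative
      (\<lambda>v. (v v* hessian V x) $ j)) (at x)" for j
  proof -
    let ?D = "frechet_derivative (\<lambda>x. frechet_derivative V (at x) (axis j 1)) (at x)"
    have D: "((\<lambda>x. frechet_derivative V (at x) (axis j 1)) has_derivative ?D) (at x)"
      using V x by (intro Ck_on_Suc_has_derivative[of k]) auto
    have "?D v = (v v* hessian V x) $ j" for v
    proof -
      have "?D (\<Sum>i\<in>UNIV. v $ i *\<^sub>R axis i 1) = (v v* hessian V x) $ j"
        using has_derivative_linear[OF D]
        by (simp add: linear_sum linear_cmul hessian_def vector_matrix_mult_def mult.commute)
      moreover have "(\<Sum>i\<in>UNIV. v $ i *\<^sub>R axis i 1) = v"
        using basis_expansion[of v] by (simp add: scalar_mult_eq_scaleR)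
      ultimately show ?thesis by simp
    qed
    then have "?D = (\<lambda>v. (v v* hessian V x) $ j)" by blast
    then show ?thesis using D by simp
  qed
  show ?thesis
    unfolding gradient_def
    by (subst has_derivative_componentwise_within)
      (use comp in \<open>auto simp: Basis_vec_def inner_axis gradient_def\<close>)
qed

lemma hessian_symmetric:
  assumes V: "Ck_on (Suc (Suc k)) V S" and S: "open S" "x \<in> S"
  shows "hessian V x $ i $ j = hessian V x $ j $ i"
proof -
  have "((\<lambda>x. frechet_derivative V (at x) v) has_derivative
      frechet_derivative (\<lambda>x. frechet_derivative V (at x) v) (at x)) (at x)" for v
    using V S by (intro Ck_on_Suc_has_derivative[of k]) auto
  from second_derivative_symmetric[OF S Ck_on_Suc_has_derivative[OF V] this this]
  show ?thesis by (simp add: hessian_def)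
qed

text \<open>If the form were negative in direction \<open>v\<close>, the derivative of
  \<open>\<sigma> * V\<close> along \<open>v\<close>, which is 0 at \<open>p\<close>, would be
  negative just after it, and the mean value theorem would push \<open>\<sigma> * V\<close> below
  its minimum. The factor \<open>\<sigma>\<close> treats minima and maxima together.\<close>

lemma second_derivative_nonneg_at_min:
  assumes V: "Ck_on (Suc (Suc k)) V W" and W: "open W" "p \<in> W"
    and crit: "gradient V p = 0" and min: "\<And>x. x \<in> W \<Longrightarrow> \<sigma> * V p \<le> \<sigma> * V x"
  shows "0 \<le> \<sigma> * ((v v* hessian V p) \<bullet> v)"
proof (rule ccontr)
  define q where "q = (v v* hessian V p) \<bullet> v"
  assume "\<not> 0 \<le> \<sigma> * ((v v* hessian V p) \<bullet> v)"
  then have q: "\<sigma> * q < 0" by (simp add: q_def)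
  have G: "(gradient V has_derivative (\<lambda>v. v v* hessian V p)) (at p)"
    by (rule gradient_has_derivative_hessian[OF V W(2)])
  have "((\<lambda>t. p + t *\<^sub>R v) has_derivative (\<lambda>h. h *\<^sub>R v)) (at 0)"
    by (auto intro!: derivative_eq_intros)
  from has_derivative_inner_left[OF has_derivative_compose[OF this], of "gradient V", simplified, OF G]
  have "((\<lambda>t. gradient V (p + t *\<^sub>R v) \<bullet> v) has_real_derivative q) (at 0)"
    by (rule has_derivative_imp_has_field_derivative)
      (simp add: q_def linear_cmul[OF has_derivative_linear[OF G]])
  from DERIV_neg_dec_right[OF DERIV_cmult[OF this] q] obtain d1 where d1: "d1 > 0"
    "\<And>h. h > 0 \<Longrightarrow> h < d1 \<Longrightarrow> \<sigma> * (gradient V (p + h *\<^sub>R v) \<bullet> v) < 0"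
    using crit by auto
  obtain d2 where d2: "d2 > 0" "ball p d2 \<subseteq> W" using W open_contains_ball by blast
  have v0: "v \<noteq> 0" using q by (auto simp: q_def)
  define t where "t = min (d1 / 2) (d2 / (2 * norm v))"
  have t: "t > 0" "t < d1" using d1 d2 v0 by (auto simp: t_def)
  have "t * norm v \<le> d2 / 2" using v0 by (simp add: t_def min_mult_distrib_right)
  then have tv: "t * norm v < d2" using d2 by simp
  have mem: "p + s *\<^sub>R v \<in> W" if "0 \<le> s" "s \<le> t" for s
  proof -
    have "s * norm v \<le> t * norm v" using that by (simp add: mult_right_mono)
    then have "p + s *\<^sub>R v \<in> ball p d2" using that tv by (simp add: dist_norm)
    then show ?thesis using d2 by blast
  qed
  have "((\<lambda>s. V (p + s *\<^sub>R v)) has_real_derivative gradient V (p + s *\<^sub>R v) \<bullet> v) (at s)"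
    if "0 \<le> s" "s \<le> t" for s
  proof -
    have "V differentiable (at (p + s *\<^sub>R v))" using V mem[OF that] by simp
    note grad = inner_gradient[OF this]
    have "((\<lambda>s. p + s *\<^sub>R v) has_derivative (\<lambda>h. h *\<^sub>R v)) (at s)"
      by (auto intro!: derivative_eq_intros)
    from has_derivative_compose[OF this Ck_on_Suc_has_derivative[OF V mem[OF that]]]
    show ?thesis by (rule has_derivative_imp_has_field_derivative) (simp flip: grad)
  qed
  then obtain x where x: "0 < x" "x < t"
    and eq: "V (p + t *\<^sub>R v) - V (p + 0 *\<^sub>R v) = (t - 0) * (gradient V (p + x *\<^sub>R v) \<bullet> v)"
    using MVT2[OF t(1), of "\<lambda>s. V (p + s *\<^sub>R v)" "\<lambda>s. gradient V (p + s *\<^sub>R v) \<bullet> v"] by auto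
  have "\<sigma> * V (p + t *\<^sub>R v) - \<sigma> * V p = \<sigma> * (V (p + t *\<^sub>R v) - V (p + 0 *\<^sub>R v))"
    by (simp add: right_diff_distrib)
  also have "\<dots> = t * (\<sigma> * (gradient V (p + x *\<^sub>R v) \<bullet> v))" unfolding eq by simp
  also have "\<dots> < 0" using d1(2)[of x] x t by (simp add: mult_pos_neg)
  finally show False using min[OF mem[of t]] t by simp
qed

lemma hessian_quadratic_form:
  assumes "Ck_on (Suc (Suc k)) V S" "open S" "x \<in> S"
  shows "(v v* hessian V x) \<bullet> v = hessian V x $ 1 $ 1 * (v $ 1)\<^sup>2
    + 2 * hessian V x $ 1 $ 2 * v $ 1 * v $ 2 + hessian V x $ 2 $ 2 * (v $ 2)\<^sup>2"
  using hessian_symmetric[OF assms, of 2 1]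
  by (simp add: vector_matrix_mult_def inner_vec_def sum_2 power2_eq_square algebra_simps)

text \<open>On a small punctured disc, which is connected, \<open>V\<close> avoids the value
  \<open>V p\<close>, so it lies strictly on one side of it and \<open>p\<close> is an extremum. The
  Hessian is then semidefinite up to sign, and the nonzero determinant makes it definite.\<close>

lemma isolated_level_hessian_definite:
  assumes V: "Ck_on (Suc (Suc k)) V W" and W: "open W" "p \<in> W"
    and crit: "gradient V p = 0" and det: "det (hessian V p) \<noteq> 0"
    and level: "{x \<in> W. V x = V p} = {p}"
  obtains \<sigma> :: real where "\<And>v. v \<noteq> 0 \<Longrightarrow> 0 < \<sigma> * ((v v* hessian V p) \<bullet> v)"
proof -
  obtain e where e: "e > 0" "ball p e \<subseteq> W" using W open_contains_ball by blast
  let ?S = "ball p e - {p}"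
  have ne: "V x \<noteq> V p" if "x \<in> ?S" for x using that level e by blast
  have "continuous_on ?S V" using Ck_on_imp_continuous_on[OF V] e by (blast intro: continuous_on_subset)
  moreover have "connected ?S" by (rule connected_punctured_ball) simp
  ultimately have conn: "connected (V ` ?S)" by (rule connected_continuous_image)
  have "(\<forall>x\<in>?S. V p < V x) \<or> (\<forall>x\<in>?S. V x < V p)"
  proof (rule ccontr)
    assume "\<not> ?thesis"
    then have "\<exists>x\<in>?S. V x \<le> V p" "\<exists>y\<in>?S. V p \<le> V y" by (meson not_less)+
    then obtain x y where "x \<in> ?S" "y \<in> ?S" "V x \<le> V p" "V p \<le> V y" by metis
    then have "V p \<in> V ` ?S" using connectedD_interval[OF conn, of "V x" "V y" "V p"] by blast
    then show False using ne by force
  qed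
  then have "\<exists>\<sigma>::real. \<sigma> \<noteq> 0 \<and> (\<forall>x\<in>ball p e. \<sigma> * V p \<le> \<sigma> * V x)"
  proof
    assume *: "\<forall>x\<in>?S. V p < V x"
    have "V p \<le> V x" if "x \<in> ball p e" for x using * that by (cases "x = p") (auto intro: less_imp_le)
    then show ?thesis by (intro exI[of _ 1]) auto
  next
    assume *: "\<forall>x\<in>?S. V x < V p"
    have "V x \<le> V p" if "x \<in> ball p e" for x using * that by (cases "x = p") (auto intro: less_imp_le)
    then show ?thesis by (intro exI[of _ "-1"]) auto
  qed
  then obtain \<sigma> :: real where \<sigma>: "\<sigma> \<noteq> 0" "\<And>x. x \<in> ball p e \<Longrightarrow> \<sigma> * V p \<le> \<sigma> * V x" by blast
  have Vb: "Ck_on (Suc (Suc k)) V (ball p e)"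
    by (rule Ck_on_subset[OF V e(2)])
  let ?H = "hessian V p"
  have form: "\<sigma> * ((v v* ?H) \<bullet> v) = (\<sigma> * ?H $ 1 $ 1) * (v $ 1)\<^sup>2
      + 2 * (\<sigma> * ?H $ 1 $ 2) * v $ 1 * v $ 2 + (\<sigma> * ?H $ 2 $ 2) * (v $ 2)\<^sup>2" for v
    unfolding hessian_quadratic_form[OF V W] by (simp add: algebra_simps)
  have nn: "0 \<le> (\<sigma> * ?H $ 1 $ 1) * x\<^sup>2 + 2 * (\<sigma> * ?H $ 1 $ 2) * x * y + (\<sigma> * ?H $ 2 $ 2) * y\<^sup>2" for x y
    using second_derivative_nonneg_at_min[OF Vb _ _ crit \<sigma>(2), of "vector [x, y]"] e
    by (simp add: form)
  have "(\<sigma> * ?H $ 1 $ 1) * (\<sigma> * ?H $ 2 $ 2) - (\<sigma> * ?H $ 1 $ 2)\<^sup>2 = \<sigma>\<^sup>2 * det ?H"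
    using hessian_symmetric[OF V W, of 2 1] by (simp add: det_2 power2_eq_square algebra_simps)
  then have d0: "(\<sigma> * ?H $ 1 $ 1) * (\<sigma> * ?H $ 2 $ 2) - (\<sigma> * ?H $ 1 $ 2)\<^sup>2 \<noteq> 0" using det \<sigma> by simp
  have "0 < \<sigma> * ((v v* ?H) \<bullet> v)" if "v \<noteq> 0" for v
    unfolding form using that
    by (intro real_quadratic_form_definite[OF nn d0]) (auto simp: vec_eq_iff forall_2)
  then show thesis by (rule that)
qed

section \<open>Quadratic growth of the first integral in a chart\<close>

text \<open>A product of two maps vanishing at 0 agrees with the product of their linear parts up to
  a quadratically small error. It is meant for the gradient of \<open>V\<close> in the chart and the
  radial velocity of the chart.\<close>

lemma inner_derivatives_quadratic_approx:
  fixes P E :: "'a::real_normed_vector \<Rightarrow> 'b::real_inner"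
  assumes P: "(P has_derivative P') (at 0)" "P 0 = 0" and E: "(E has_derivative E') (at 0)" "E 0 = 0"
    and e: "e > 0"
  shows "\<exists>d>0. \<forall>z\<in>ball 0 d. \<bar>P z \<bullet> E z - P' z \<bullet> E' z\<bar> \<le> e * (norm z)\<^sup>2"
proof -
  obtain B1 where B1: "B1 > 0" "\<And>z. norm (P' z) \<le> norm z * B1"
    using bounded_linear.pos_bounded[OF has_derivative_bounded_linear[OF P(1)]] by blast
  obtain B2 where B2: "B2 > 0" "\<And>z. norm (E' z) \<le> norm z * B2"
    using bounded_linear.pos_bounded[OF has_derivative_bounded_linear[OF E(1)]] by blast
  \<comment> \<open>The cap 1 gives \<open>norm (E z) \<le> (B2 + 1) * norm z\<close>; the two error
    terms then sum to \<open>\<eta> * (B1 + B2 + 1) * (norm z)\<^sup>2\<close>.\<close>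
  define \<eta> where "\<eta> = min 1 (e / (B1 + B2 + 1))"
  have B: "0 < B1 + B2 + 1" using B1 B2 by simp
  have "\<eta> \<le> e / (B1 + B2 + 1)" by (simp add: \<eta>_def)
  with B have "\<eta> * (B1 + B2 + 1) \<le> e" by (simp only: pos_le_divide_eq)
  moreover have "0 < \<eta>" "\<eta> \<le> 1" using e B by (auto simp: \<eta>_def)
  ultimately have \<eta>: "0 < \<eta>" "\<eta> \<le> 1" "\<eta> * (B1 + B2 + 1) \<le> e" by auto
  obtain d1 where d1: "d1 > 0" "\<And>z. norm z < d1 \<Longrightarrow> norm (P z - P' z) \<le> \<eta> * norm z"
    using P \<eta>(1) unfolding has_derivative_at_alt by (metis diff_zero)
  obtain d2 where d2: "d2 > 0" "\<And>z. norm z < d2 \<Longrightarrow> norm (E z - E' z) \<le> \<eta> * norm z"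
    using E \<eta>(1) unfolding has_derivative_at_alt by (metis diff_zero)
  have "\<bar>P z \<bullet> E z - P' z \<bullet> E' z\<bar> \<le> e * (norm z)\<^sup>2" if "z \<in> ball 0 (min d1 d2)" for z
  proof -
    have z: "norm z < d1" "norm z < d2" using that by auto
    note a = d1(2)[OF z(1)] d2(2)[OF z(2)]
    have Ez: "norm (E z) \<le> (B2 + 1) * norm z"
    proof -
      have "norm (E z) \<le> norm (E z - E' z) + norm (E' z)" using norm_triangle_ineq[of "E z - E' z" "E' z"] by simp
      also have "\<dots> \<le> 1 * norm z + norm z * B2"
        by (intro add_mono B2 order_trans[OF a(2)] mult_right_mono \<eta>) auto
      finally show ?thesis by (simp add: algebra_simps)
    qed
    have "P z \<bullet> E z - P' z \<bullet> E' z = (P z - P' z) \<bullet> E z + P' z \<bullet> (E z - E' z)"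
      by (simp add: inner_diff_left inner_diff_right)
    then have "\<bar>P z \<bullet> E z - P' z \<bullet> E' z\<bar> \<le> \<bar>(P z - P' z) \<bullet> E z\<bar> + \<bar>P' z \<bullet> (E z - E' z)\<bar>" by simp
    also have "\<dots> \<le> norm (P z - P' z) * norm (E z) + norm (P' z) * norm (E z - E' z)"
      by (intro add_mono Cauchy_Schwarz_ineq2)
    also have "\<dots> \<le> (\<eta> * norm z) * ((B2 + 1) * norm z) + (norm z * B1) * (\<eta> * norm z)"
      using \<eta> B1 B2 by (intro add_mono mult_mono a Ez) auto
    also have "\<dots> = \<eta> * (B1 + B2 + 1) * (norm z)\<^sup>2" by (simp add: power2_eq_square algebra_simps)
    also have "\<dots> \<le> e * (norm z)\<^sup>2" by (intro mult_right_mono \<eta>) auto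
    finally show ?thesis .
  qed
  then show ?thesis using d1 d2 by (intro exI[of _ "min d1 d2"]) auto
qed

text \<open>The constants are the minimum and maximum of \<open>Q\<close> on the compact unit
  sphere; homogeneity of degree 2 extends the bounds to all vectors.\<close>

lemma definite_quadratic_bounds:
  fixes Q :: "'a::euclidean_space \<Rightarrow> real"
  assumes Q: "continuous_on UNIV Q" and hom: "\<And>t z. Q (t *\<^sub>R z) = t\<^sup>2 * Q z" and pos: "\<And>z. z \<noteq> 0 \<Longrightarrow> 0 < Q z"
  obtains c C where "0 < c" "\<And>z. c * (norm z)\<^sup>2 \<le> Q z" "\<And>z. Q z \<le> C * (norm z)\<^sup>2"
proof -
  let ?S = "sphere 0 1 :: 'a set"
  have S: "compact ?S" "?S \<noteq> {}" "continuous_on ?S Q"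
    using Q continuous_on_subset by auto
  obtain x where x: "x \<in> ?S" "\<And>y. y \<in> ?S \<Longrightarrow> Q x \<le> Q y"
    using continuous_attains_inf[OF S] by blast
  obtain X where X: "\<And>y. y \<in> ?S \<Longrightarrow> Q y \<le> Q X"
    using continuous_attains_sup[OF S] by blast
  have Q0: "Q 0 = 0" using hom[of 0 0] by simp
  have *: "Q z = Q (sgn z) * (norm z)\<^sup>2" for z
  proof -
    have "norm z *\<^sub>R sgn z = z" by (cases "z = 0") (simp_all add: sgn_div_norm)
    then show ?thesis using hom[of "norm z" "sgn z"] by (simp add: mult.commute)
  qed
  show thesis
  proof (rule that[of "Q x" "Q X"])
    show "0 < Q x" using pos[of x] x(1) by (cases "x = 0") auto
    show "Q x * (norm z)\<^sup>2 \<le> Q z" for z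
      using x(2)[of "sgn z"] by (cases "z = 0") (auto simp: *[of z] norm_sgn Q0 intro!: mult_right_mono)
    show "Q z \<le> Q X * (norm z)\<^sup>2" for z
      using X[of "sgn z"] by (cases "z = 0") (auto simp: *[of z] norm_sgn Q0 intro!: mult_right_mono)
  qed
qed

text \<open>A radial derivative comparable to the squared norm yields, along the segment from 0,
  both the quadratic bounds and the strict monotonicity on rays required by the twist
  argument.\<close>

lemma radial_derivative_growth:
  fixes \<phi> :: "'a::real_normed_vector \<Rightarrow> real"
  assumes \<phi>0: "\<phi> 0 = 0" and c: "0 < c"
    and der: "\<And>z. z \<in> ball 0 R \<Longrightarrow> (\<phi> has_derivative \<phi>' z) (at z)"
    and bounds: "\<And>z. z \<in> ball 0 R \<Longrightarrow> c * (norm z)\<^sup>2 \<le> \<phi>' z z \<and> \<phi>' z z \<le> C * (norm z)\<^sup>2"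
    and z: "z \<in> ball 0 R"
  shows "c / 2 * (norm z)\<^sup>2 \<le> \<phi> z" "\<phi> z \<le> C / 2 * (norm z)\<^sup>2"
    and "z \<noteq> 0 \<Longrightarrow> 0 < s \<Longrightarrow> s < 1 \<Longrightarrow> \<phi> (s *\<^sub>R z) < \<phi> z"
proof -
  have mem: "t *\<^sub>R z \<in> ball 0 R" if "0 \<le> t" "t \<le> 1" for t
    using z that mult_left_le_one_le[of "norm z" t] by simp
  have D: "((\<lambda>t. \<phi> (t *\<^sub>R z)) has_real_derivative \<phi>' (t *\<^sub>R z) z) (at t)" if "0 \<le> t" "t \<le> 1" for t
  proof -
    have "((\<lambda>t. t *\<^sub>R z) has_derivative (\<lambda>h. h *\<^sub>R z)) (at t)" by (auto intro!: derivative_eq_intros)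
    from has_derivative_compose[OF this der[OF mem[OF that]]]
    show ?thesis
      by (rule has_derivative_imp_has_field_derivative)
        (simp add: linear_cmul[OF has_derivative_linear[OF der[OF mem[OF that]]]])
  qed
  have B: "c * t * (norm z)\<^sup>2 \<le> \<phi>' (t *\<^sub>R z) z" "\<phi>' (t *\<^sub>R z) z \<le> C * t * (norm z)\<^sup>2" if "0 < t" "t \<le> 1" for t
  proof -
    have t: "0 \<le> t" "t \<le> 1" using that by auto
    have "\<phi>' (t *\<^sub>R z) (t *\<^sub>R z) = t * \<phi>' (t *\<^sub>R z) z"
      by (simp add: linear_cmul[OF has_derivative_linear[OF der[OF mem[OF t]]]])
    then have "t * (c * t * (norm z)\<^sup>2) \<le> t * \<phi>' (t *\<^sub>R z) z" "t * \<phi>' (t *\<^sub>R z) z \<le> t * (C * t * (norm z)\<^sup>2)"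
      using bounds[OF mem[OF t]] that by (simp_all add: power_mult_distrib power2_eq_square mult_ac)
    then show "c * t * (norm z)\<^sup>2 \<le> \<phi>' (t *\<^sub>R z) z" "\<phi>' (t *\<^sub>R z) z \<le> C * t * (norm z)\<^sup>2" using that by auto
  qed
  \<comment> \<open>The mean value theorem for \<open>\<phi> (t *\<^sub>R z) - a * t\<^sup>2\<close>
    replaces an integration. With \<open>a\<close> equal to \<open>c / 2\<close> or
    \<open>C / 2\<close> times the squared norm, the right-hand side has a definite sign by
    \<open>B\<close>.\<close>
  have MV: "\<exists>t. 0 < t \<and> t < 1 \<and> \<phi> z - a = \<phi>' (t *\<^sub>R z) z - 2 * a * t" for a
  proof -
    have "\<exists>t. 0 < t \<and> t < 1 \<and> (\<phi> (1 *\<^sub>R z) - a * 1\<^sup>2) - (\<phi> (0 *\<^sub>R z) - a * 0\<^sup>2) = (1 - 0) * (\<phi>' (t *\<^sub>R z) z - 2 * a * t)"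
      by (rule MVT2) (auto intro!: derivative_eq_intros D)
    then show ?thesis by (simp add: \<phi>0)
  qed
  show "c / 2 * (norm z)\<^sup>2 \<le> \<phi> z"
  proof -
    obtain t where "0 < t" "t < 1" "\<phi> z - c / 2 * (norm z)\<^sup>2 = \<phi>' (t *\<^sub>R z) z - 2 * (c / 2 * (norm z)\<^sup>2) * t"
      using MV by blast
    then show ?thesis using B(1)[of t] by (simp add: mult_ac)
  qed
  show "\<phi> z \<le> C / 2 * (norm z)\<^sup>2"
  proof -
    obtain t where "0 < t" "t < 1" "\<phi> z - C / 2 * (norm z)\<^sup>2 = \<phi>' (t *\<^sub>R z) z - 2 * (C / 2 * (norm z)\<^sup>2) * t"
      using MV by blast
    then show ?thesis using B(2)[of t] by (simp add: mult_ac)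
  qed
  show "\<phi> (s *\<^sub>R z) < \<phi> z" if s: "z \<noteq> 0" "0 < s" "s < 1"
  proof -
    obtain t where t: "s < t" "t < 1" "\<phi> (1 *\<^sub>R z) - \<phi> (s *\<^sub>R z) = (1 - s) * \<phi>' (t *\<^sub>R z) z"
      using MVT2[OF s(3), of "\<lambda>t. \<phi> (t *\<^sub>R z)" "\<lambda>t. \<phi>' (t *\<^sub>R z) z"] D s by auto
    have "0 < c * t * (norm z)\<^sup>2" using c t that by simp
    also have "\<dots> \<le> \<phi>' (t *\<^sub>R z) z" using B(1)[of t] t that by simp
    finally have "0 < (1 - s) * \<phi>' (t *\<^sub>R z) z" using that by simp
    then show ?thesis using t(3) by simp
  qed
qed

text \<open>By the chain rule the radial derivative is an inner product of two maps vanishing at 0,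
  namely the gradient at \<open>g z\<close> and the velocity
  \<open>frechet_derivative g (at z) z\<close>. Its leading part is the Hessian form pulled back by
  the injective linear map \<open>frechet_derivative g (at 0)\<close>, which is definite.\<close>

lemma integral_radial_derivative_in_chart:
  fixes V :: "real ^ 2 \<Rightarrow> real" and g :: "complex \<Rightarrow> real ^ 2"
  assumes V: "Ck_on (Suc (Suc k)) V W" and W: "open W" "p \<in> W" and crit: "gradient V p = 0"
    and g: "Ck_on (Suc (Suc m)) g A" and A: "open A" "0 \<in> A" "g 0 = p"
    and inj: "inj (frechet_derivative g (at 0))"
    and definite: "\<And>v. v \<noteq> 0 \<Longrightarrow> 0 < \<sigma> * ((v v* hessian V p) \<bullet> v)"
  defines "\<phi> \<equiv> \<lambda>z. \<sigma> * (V (g z) - V p)"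
    and "\<phi>' \<equiv> \<lambda>z w. \<sigma> * (gradient V (g z) \<bullet> frechet_derivative g (at z) w)"
  shows "\<exists>R c C. 0 < R \<and> 0 < c \<and> (\<forall>z\<in>ball 0 R. z \<in> A \<and> g z \<in> W \<and> (\<phi> has_derivative \<phi>' z) (at z) \<and>
    c * (norm z)\<^sup>2 \<le> \<phi>' z z \<and> \<phi>' z z \<le> C * (norm z)\<^sup>2)"
proof -
  let ?D = "\<lambda>z. frechet_derivative g (at z)"
  have Dg: "(g has_derivative ?D z) (at z)" if "z \<in> A" for z
    using Ck_on_Suc_has_derivative[OF g that] .
  have lin: "linear (?D z)" if "z \<in> A" for z using Dg[OF that] has_derivative_linear by blast
  have Dz: "?D z w = Re w *\<^sub>R ?D z 1 + Im w *\<^sub>R ?D z \<i>" if "z \<in> A" for z w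
  proof -
    have "?D z (Re w *\<^sub>R 1 + Im w *\<^sub>R \<i>) = Re w *\<^sub>R ?D z 1 + Im w *\<^sub>R ?D z \<i>"
      by (simp only: linear_add[OF lin[OF that]] linear_cmul[OF lin[OF that]])
    moreover have "Re w *\<^sub>R 1 + Im w *\<^sub>R \<i> = w" by (simp add: complex_eq_iff)
    ultimately show ?thesis by simp
  qed
  have D2: "((\<lambda>z. ?D z v) has_derivative frechet_derivative (\<lambda>z. ?D z v) (at 0)) (at 0)" for v
    using g A by (intro Ck_on_Suc_has_derivative[of m]) auto
  have Re0: "(Re has_derivative Re) (at 0)" and Im0: "(Im has_derivative Im) (at 0)"
    by (auto intro: bounded_linear_imp_has_derivative bounded_linear_Re bounded_linear_Im)
  \<comment> \<open>On \<open>A\<close> this is \<open>?D z z\<close>. It is expanded in the fixed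
    directions 1 and \<open>\<i>\<close> because \<open>Ck_on\<close> gives differentiability of
    \<open>?D z v\<close> in \<open>z\<close> for fixed \<open>v\<close> only. At 0 the derivatives
    of the coefficients are multiplied by \<open>Re 0\<close> and \<open>Im 0\<close> and drop
    out.\<close>
  define E where "E = (\<lambda>z. Re z *\<^sub>R ?D z 1 + Im z *\<^sub>R ?D z \<i>)"
  have "(E has_derivative (\<lambda>w. Re w *\<^sub>R ?D 0 1 + Im w *\<^sub>R ?D 0 \<i>)) (at 0)"
    unfolding E_def by (auto intro!: derivative_eq_intros D2 Re0 Im0)
  then have E: "(E has_derivative ?D 0) (at 0)" by (simp only: Dz[OF A(2), symmetric])
  have G: "(gradient V has_derivative (\<lambda>v. v v* hessian V p)) (at (g 0))"
    using gradient_has_derivative_hessian[OF V W(2)] A by simp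
  have P: "((\<lambda>z. gradient V (g z)) has_derivative (\<lambda>z. ?D 0 z v* hessian V p)) (at 0)"
    using has_derivative_compose[OF Dg[OF A(2)] G] .
  have linP: "linear (\<lambda>v. v v* hessian V p)" using G has_derivative_linear by blast
  define Q where "Q = (\<lambda>z. \<sigma> * ((?D 0 z v* hessian V p) \<bullet> ?D 0 z))"
  have contQ: "continuous_on UNIV Q"
    unfolding Q_def using has_derivative_linear[OF P] lin[OF A(2)]
    by (intro continuous_intros linear_continuous_on linear_conv_bounded_linear[THEN iffD1])
  have homQ: "Q (t *\<^sub>R z) = t\<^sup>2 * Q z" for t z
    by (simp add: Q_def linear_cmul[OF lin[OF A(2)]] linear_cmul[OF linP] power2_eq_square)
  have posQ: "0 < Q z" if "z \<noteq> 0" for z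
  proof -
    have "?D 0 z \<noteq> 0" using inj that linear_injective_0[OF lin[OF A(2)]] by blast
    then show ?thesis unfolding Q_def by (rule definite)
  qed
  obtain c C where c: "0 < c" "\<And>z. c * (norm z)\<^sup>2 \<le> Q z" "\<And>z. Q z \<le> C * (norm z)\<^sup>2"
    using definite_quadratic_bounds[OF contQ homQ posQ] by metis
  have \<sigma>0: "\<sigma> \<noteq> 0" using posQ[of 1] by (auto simp: Q_def)
  \<comment> \<open>The tolerance is chosen so that, after multiplication by
    \<open>\<sigma>\<close>, the error takes away only half of the lower constant
    \<open>c\<close>.\<close>
  obtain d1 where d1: "d1 > 0" "\<And>z. z \<in> ball 0 d1 \<Longrightarrow> \<bar>gradient V (g z) \<bullet> E z - (?D 0 z v* hessian V p) \<bullet> ?D 0 z\<bar>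
      \<le> c / (2 * \<bar>\<sigma>\<bar>) * (norm z)\<^sup>2"
    using inner_derivatives_quadratic_approx[OF P _ E, of "c / (2 * \<bar>\<sigma>\<bar>)"] crit A c \<sigma>0
    by (auto simp: E_def)
  have "isCont g 0" using Dg[OF A(2)] has_derivative_continuous by blast
  then have "(g \<longlongrightarrow> g 0) (nhds 0)" unfolding isCont_def tendsto_at_iff_tendsto_nhds .
  then have "eventually (\<lambda>z. g z \<in> W) (nhds 0)"
    using W A by (intro topological_tendstoD) auto
  moreover have "eventually (\<lambda>z. z \<in> A) (nhds 0)" using A eventually_nhds_in_open by blast
  ultimately have "eventually (\<lambda>z. g z \<in> W \<and> z \<in> A) (nhds 0)" by eventually_elim auto
  then obtain d2 where d2: "d2 > 0" "\<And>z. z \<in> ball 0 d2 \<Longrightarrow> g z \<in> W \<and> z \<in> A"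
    unfolding eventually_nhds_metric by (auto simp: dist_commute)
  have "z \<in> A \<and> g z \<in> W \<and> (\<phi> has_derivative \<phi>' z) (at z) \<and>
    c / 2 * (norm z)\<^sup>2 \<le> \<phi>' z z \<and> \<phi>' z z \<le> (C + c / 2) * (norm z)\<^sup>2" if "z \<in> ball 0 (min d1 d2)" for z
  proof -
    have z: "z \<in> A" "g z \<in> W" using that d2(2)[of z] by auto
    have Vd: "V differentiable (at (g z))" using V z by simp
    have "((\<lambda>z. V (g z)) has_derivative (\<lambda>w. gradient V (g z) \<bullet> ?D z w)) (at z)"
      using has_derivative_compose[OF Dg[OF z(1)] Ck_on_Suc_has_derivative[OF V z(2)]]
      by (simp add: inner_gradient[OF Vd])
    then have "(\<phi> has_derivative \<phi>' z) (at z)"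
      unfolding \<phi>_def \<phi>'_def by (auto intro!: derivative_eq_intros)
    moreover have "\<bar>\<phi>' z z - Q z\<bar> \<le> c / 2 * (norm z)\<^sup>2"
    proof -
      have "E z = ?D z z" unfolding E_def by (rule Dz[OF z(1), symmetric])
      then have "\<bar>\<phi>' z z - Q z\<bar> = \<bar>\<sigma>\<bar> * \<bar>gradient V (g z) \<bullet> E z - (?D 0 z v* hessian V p) \<bullet> ?D 0 z\<bar>"
        by (simp add: \<phi>'_def Q_def abs_mult[symmetric] right_diff_distrib)
      also have "\<dots> \<le> \<bar>\<sigma>\<bar> * (c / (2 * \<bar>\<sigma>\<bar>) * (norm z)\<^sup>2)"
        using that by (intro mult_left_mono d1) auto
      also have "\<dots> = c / 2 * (norm z)\<^sup>2" using \<sigma>0 by simp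
      finally show ?thesis .
    qed
    then have "c / 2 * (norm z)\<^sup>2 \<le> \<phi>' z z" "\<phi>' z z \<le> (C + c / 2) * (norm z)\<^sup>2"
      using c(2)[of z] c(3)[of z] unfolding abs_le_iff by (simp_all add: algebra_simps)
    ultimately show ?thesis using z by blast
  qed
  then show ?thesis using d1 d2 c(1)
    by (intro exI[of _ "min d1 d2"] exI[of _ "c / 2"] exI[of _ "C + c / 2"]) auto
qed

section \<open>From the Birkhoff normal form to infinitely many periodic points\<close>

theorem theorem1:
  fixes n :: nat and U :: "(real ^ 2) set" and F :: "real ^ 2 \<Rightarrow> real ^ 2" and p :: "real ^ 2"
    and \<nu> :: "real ^ 2 \<Rightarrow> real" and B :: "nat \<Rightarrow> complex" and b :: real and N :: "nat \<Rightarrow> nat"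
  assumes "n \<ge> 1"
    and "open U" and "Ck_on (2 * n + 2) F U"
    and "elliptic_fixed_point U F p" and "\<not> k_resonant F p (2 * n + 1)"
    and "birkhoff_constants U F p (2 * n + 1) B"
    and "\<forall>j\<in>{1..<n}. B j = 0" and "B n = \<i> * complex_of_real b" and "b \<noteq> 0"
    and "Ck_on (2 * n + 3) \<nu> U" and "\<forall>x\<in>U. \<nu> x \<noteq> 0"
    and "measure_preserving_density U F \<nu>"
    and "\<not> bdd_above (range N)" and "\<forall>k. finite (periodic_points U F (N k))"
  shows "\<not> Cm_locally_integrable (2 * n + 4) U F p"
proof
  assume "Cm_locally_integrable (2 * n + 4) U F p"
  then obtain W V where W: "open W" "p \<in> W" "W \<subseteq> U" and V: "Ck_on (Suc (Suc (2 * n + 2))) V W"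
    and inv: "\<And>x. x \<in> W \<Longrightarrow> F x \<in> W \<Longrightarrow> V (F x) = V x"
    and level: "{x \<in> W. V x = V p} = {p}"
    and crit: "p isolated_in critical_points V W" and hess: "det (hessian V p) \<noteq> 0"
    unfolding Cm_locally_integrable_def by (auto simp: numeral_eq_Suc)
  have crit0: "gradient V p = 0"
    using crit by (auto simp: isolated_in_def critical_points_def gradient_def vec_eq_iff)
  obtain \<sigma> where definite: "\<And>v. v \<noteq> 0 \<Longrightarrow> 0 < \<sigma> * ((v v* hessian V p) \<bullet> v)"
    using isolated_level_hessian_definite[OF V W(1,2) crit0 hess level] by blast
  have k: "(2 * n + 1 - 1) div 2 = n" by simp
  obtain A A' h g l where A: "open A" "p \<in> A" "A \<subseteq> U" "open A'" and hom: "homeomorphism A A' h g"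
    and Ch: "Ck_on (2 * n + 1) h A" and Cg: "Ck_on (2 * n + 1) g A'" and hp: "h p = 0"
    and l: "complex_eigenvalue (jacobian_at F p) l"
    and birkhoff: "(\<lambda>z. h (F (g z)) - l * z * (1 + (\<Sum>j = 1..n. B j * (z * cnj z) ^ j)))
          \<in> o[at 0](\<lambda>z. complex_of_real (cmod z ^ (2 * n + 1)))"
    using assms(6) unfolding birkhoff_constants_def k by blast
  have Fp: "F p = p" and l1: "cmod l = 1" using assms(4) l by (auto simp: elliptic_fixed_point_def)
  \<comment> \<open>Since \<open>n \<ge> 1\<close>, the chart is at least three times continuously
    differentiable; \<open>n'\<close> exposes the two derivatives that the chart lemma asks
    for.\<close>
  obtain n' where n': "n = Suc n'" using assms(1) by (cases n) auto
  have Ch': "Ck_on (Suc (2 * n)) h A" using Ch by simp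
  have Cg': "Ck_on (Suc (Suc (2 * n' + 1))) g A'" using Cg by (simp add: n')
  have gh: "g (h x) = x" if "x \<in> A" for x using hom that by (simp add: homeomorphism_apply1)
  have hg: "h (g z) = z" if "z \<in> A'" for z using hom that by (simp add: homeomorphism_apply2)
  have A0: "0 \<in> A'" using hom A(2) hp unfolding homeomorphism_def by force
  have g0: "g 0 = p" using gh[OF A(2)] hp by simp
  have contF: "isCont F x" if "x \<in> U" for x
    using Ck_on_imp_continuous_on[OF assms(3)] assms(2) that by (simp add: continuous_on_eq_continuous_at)
  have conth: "isCont h x" if "x \<in> A" for x
    using Ck_on_imp_continuous_on[OF Ch] A(1) that by (simp add: continuous_on_eq_continuous_at)
  have contg: "isCont g z" if "z \<in> A'" for z
    using Ck_on_imp_continuous_on[OF Cg] A(4) that by (simp add: continuous_on_eq_continuous_at)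
  have "inj (frechet_derivative g (at 0))"
  proof -
    have "((\<lambda>z. h (g z)) has_derivative (\<lambda>w. frechet_derivative h (at p) (frechet_derivative g (at 0) w))) (at 0)"
      using has_derivative_compose[OF Ck_on_Suc_has_derivative[OF Cg' A0], of h]
        Ck_on_Suc_has_derivative[OF Ch' A(2)] g0 by simp
    moreover have "((\<lambda>z. h (g z)) has_derivative (\<lambda>w. w)) (at 0)"
      by (rule has_derivative_transform_within_open[OF has_derivative_ident A(4) A0]) (simp add: hg)
    ultimately have "(\<lambda>w. frechet_derivative h (at p) (frechet_derivative g (at 0) w)) = (\<lambda>w. w)"
      by (rule has_derivative_unique)
    then show ?thesis by (metis injI)
  qed
  note chart = integral_radial_derivative_in_chart[OF V W(1,2) crit0 Cg' A(4) A0 g0 this definite]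
  define \<phi> where "\<phi> = (\<lambda>z. \<sigma> * (V (g z) - V p))"
  define \<phi>' where "\<phi>' = (\<lambda>z w. \<sigma> * (gradient V (g z) \<bullet> frechet_derivative g (at z) w))"
  obtain R1 c C where R1: "0 < R1" "0 < c" and rad: "\<forall>z\<in>ball 0 R1. z \<in> A' \<and> g z \<in> W \<and>
      (\<phi> has_derivative \<phi>' z) (at z) \<and> c * (cmod z)\<^sup>2 \<le> \<phi>' z z \<and> \<phi>' z z \<le> C * (cmod z)\<^sup>2"
    using chart unfolding \<phi>_def \<phi>'_def by blast
  note rad = rad[rule_format]
  define f where "f = (\<lambda>z. h (F (g z)))"
  have f0: "f 0 = 0" by (simp add: f_def g0 Fp hp)
  have "isCont (\<lambda>z. F (g z)) 0"
    using isCont_o2[OF contg[OF A0]] contF A g0 by (metis subsetD)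
  then have "((\<lambda>z. F (g z)) \<longlongrightarrow> p) (nhds 0)"
    using tendsto_at_iff_tendsto_nhds[of "\<lambda>z. F (g z)" 0] g0 Fp by (simp add: isCont_def)
  \<comment> \<open>Lying in \<open>A\<close> makes \<open>g (f z) = F (g z)\<close>, so that
    iteration carries over to the chart; lying in \<open>W\<close> makes the invariance of
    \<open>V\<close> applicable, as \<open>F\<close> need not preserve \<open>W\<close>.\<close>
  then have "eventually (\<lambda>z. F (g z) \<in> A \<inter> W) (nhds 0)"
    using A W by (intro topological_tendstoD) auto
  moreover have "eventually (\<lambda>z. cmod (f z - l * z * (1 + \<i> * of_real (b * cmod z ^ (2 * n))))
      \<le> \<bar>b\<bar> / 8 * cmod z ^ (2 * n + 1)) (nhds 0)"
  proof -
    have "(\<Sum>j = 1..n. B j * (z * cnj z) ^ j) = \<i> * of_real (b * cmod z ^ (2 * n))" for z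
    proof -
      have "(\<Sum>j = 1..n. B j * (z * cnj z) ^ j) = (\<Sum>j\<in>{n}. B j * (z * cnj z) ^ j)"
        using assms(1,7) by (intro sum.mono_neutral_right) auto
      also have "\<dots> = \<i> * of_real (b * cmod z ^ (2 * n))"
        by (simp add: assms(8) power_mult flip: complex_norm_square)
      finally show ?thesis .
    qed
    \<comment> \<open>Only the term with index \<open>n\<close> survives in the normal form, and the
      remainder is estimated with constant \<open>\<bar>b\<bar> / 8\<close>. The estimate extends
      from punctured to full neighbourhoods because \<open>f\<close> fixes 0.\<close>
    with landau_o.smallD[OF birkhoff, of "\<bar>b\<bar> / 8"] assms(9)
    have "eventually (\<lambda>z. cmod (f z - l * z * (1 + \<i> * of_real (b * cmod z ^ (2 * n))))
      \<le> \<bar>b\<bar> / 8 * cmod z ^ (2 * n + 1)) (at 0)"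
      by (simp add: f_def norm_power norm_mult)
    then show ?thesis by (subst eventually_nhds_conv_at) (simp add: f0)
  qed
  ultimately have "eventually (\<lambda>z. F (g z) \<in> A \<inter> W \<and> cmod (f z - l * z * (1 + \<i> * of_real (b * cmod z ^ (2 * n))))
      \<le> \<bar>b\<bar> / 8 * cmod z ^ (2 * n + 1)) (nhds 0)"
    by (rule eventually_conj)
  then obtain R2 where R2: "R2 > 0" and loc: "\<And>z. z \<in> ball 0 R2 \<Longrightarrow> F (g z) \<in> A \<inter> W \<and>
      cmod (f z - l * z * (1 + \<i> * of_real (b * cmod z ^ (2 * n)))) \<le> \<bar>b\<bar> / 8 * cmod z ^ (2 * n + 1)"
    unfolding eventually_nhds_metric by (auto simp: dist_commute)
  define R where "R = min R1 R2"
  have R: "R > 0" using R1 R2 by (simp add: R_def)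
  have in1: "z \<in> ball 0 R1" and in2: "z \<in> ball 0 R2" if "z \<in> ball 0 R" for z :: complex
    using that by (auto simp: R_def)
  have \<phi>0: "\<phi> 0 = 0" by (simp add: \<phi>_def g0)
  note growth = radial_derivative_growth[of \<phi> c R1 \<phi>' C, OF \<phi>0 R1(2)]
  have quad: "\<forall>z\<in>ball 0 R. c / 2 * (cmod z)\<^sup>2 \<le> \<phi> z \<and> \<phi> z \<le> C / 2 * (cmod z)\<^sup>2"
    using growth(1,2) rad in1 by blast
  have ray: "\<phi> (of_real s * z) < \<phi> z" if "z \<in> ball 0 R" "z \<noteq> 0" "0 < s" "s < 1" for z s
    using growth(3)[OF _ _ in1[OF that(1)] that(2-4)] rad by (simp add: scaleR_conv_of_real)
  have contf: "continuous_on (ball 0 R) f"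
  proof (intro continuous_at_imp_continuous_on ballI)
    fix z :: complex assume z: "z \<in> ball 0 R"
    have z': "z \<in> A'" "g z \<in> U" "F (g z) \<in> A" using rad[OF in1[OF z]] loc[OF in2[OF z]] W by auto
    have "isCont (\<lambda>z. F (g z)) z" by (rule isCont_o2[OF contg[OF z'(1)] contF[OF z'(2)]])
    from isCont_o2[OF this conth[OF z'(3)]] show "isCont f z" by (simp add: f_def)
  qed
  have gf: "g (f z) = F (g z)" if "z \<in> ball 0 R" for z
    using gh loc[OF in2[OF that]] by (simp add: f_def)
  have invf: "\<forall>z\<in>ball 0 R. f z \<in> ball 0 R \<longrightarrow> \<phi> (f z) = \<phi> z"
    using gf inv rad in1 loc in2 by (simp add: \<phi>_def)
  have twist: "\<forall>z\<in>ball 0 R. cmod (f z - l * z * (1 + \<i> * of_real (b * cmod z ^ (2 * n))))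
      \<le> \<bar>b\<bar> / 8 * cmod z ^ (2 * n + 1)"
    using loc in2 by blast
  have c2: "0 < c / 2" using R1 by simp
  obtain N0 where N0: "\<forall>M\<ge>N0. \<forall>u. cmod u = 1 \<longrightarrow> (\<exists>r>0. (\<forall>j. (f ^^ j) (of_real r * u) \<in> ball 0 R) \<and>
      (f ^^ M) (of_real r * u) = of_real r * u)"
    using twist_periodic_orbits_on_rays[OF assms(1) R l1 assms(9) contf twist c2 quad ray invf] by blast
  obtain k where k: "N k \<ge> N0" using assms(13) unfolding bdd_above_def by (metis linear rangeE)
  \<comment> \<open>All iterates are required to stay in the ball, so the conjugacy applies at every
    step and the image orbit under \<open>g\<close> stays in \<open>U\<close>.\<close>
  define Z where "Z = {z. (\<forall>j. (f ^^ j) z \<in> ball 0 R) \<and> (f ^^ N k) z = z}"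
  have orbit: "(F ^^ j) (g z) = g ((f ^^ j) z)" if "z \<in> Z" for z j
    using that by (induction j) (auto simp: Z_def gf)
  have "g ` Z \<subseteq> periodic_points U F (N k)"
    using orbit rad in1 W unfolding periodic_points_def by (auto simp: Z_def)
  then have "finite (g ` Z)" using assms(14) finite_subset by blast
  moreover have ZA: "Z \<subseteq> A'"
  proof
    fix z assume "z \<in> Z"
    then have "(f ^^ 0) z \<in> ball 0 R" unfolding Z_def by blast
    then show "z \<in> A'" using rad in1 by simp
  qed
  then have "inj_on g Z" using hg by (metis inj_onI subsetD)
  \<comment> \<open>The map \<open>sgn\<close> records the ray of a point. Every ray carries a point
    of \<open>Z\<close>, so finiteness of \<open>Z\<close> would make the unit circle
    finite.\<close>
  ultimately have "finite (sgn ` Z)" using finite_imageD by blast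
  moreover have "sphere 0 1 \<subseteq> sgn ` Z"
  proof
    fix u :: complex assume "u \<in> sphere 0 1"
    then have u: "cmod u = 1" by simp
    then obtain r where "r > 0" "of_real r * u \<in> Z" using N0 k unfolding Z_def by blast
    moreover have "sgn u = u" using u by (simp add: sgn_div_norm)
    then have "sgn (of_real r * u) = u" using \<open>r > 0\<close> by (simp add: sgn_mult sgn_of_real)
    ultimately show "u \<in> sgn ` Z" by force
  qed
  ultimately have "finite (sphere (0::complex) 1)" by (rule finite_subset[rotated])
  \<comment> \<open>A finite connected set has at most one point, whereas the circle contains 1 and
    -1.\<close>
  moreover have "connected (sphere (0::complex) 1)" by (rule connected_sphere) simp
  ultimately have "sphere (0::complex) 1 = {} \<or> (\<exists>a. sphere (0::complex) 1 = {a})"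
    by (simp only: connected_finite_iff_sing)
  moreover have "1 \<in> sphere (0::complex) 1" "-1 \<in> sphere (0::complex) 1" by simp_all
  ultimately have "(1::complex) = -1" by (metis emptyE singletonD)
  then show False by simp
qed

end
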